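(* There exist constants $C_4(\ell)>0$ and $C_5(\ell)>0$ for each integer $\ell\ge1$ (depending only on $\ell$), and an absolute constant $C_7>0$, such that, with $C_6:=32\pi e$, the following holds. Let $\mathcal{X}=\{x_1,\dots,x_s\}\subset(-\pi,\pi]$ form a $(\Delta,\theta,s,\ell,\tau)_{\mathbb{T}}$-clustered configuration with $\theta\le\pi$, and let $N$ be an integer satisfying $$\frac{C_4(\ell)\,s}{\theta}\ \le\ N\ \le\ \frac{C_5(\ell)}{s\tau\Delta}.$$ Then $$\sigma_{\min}\bigl(\mathbf{V}_N(\mathcal{X})\bigr)\ \ge\ C_7\,\sqrt{N}\,\Bigl(\frac{N\Delta}{C_6}\Bigr)^{\ell-1}.$$
   Context: For a finite set of $s$ distinct nodes $\mathcal{X}=\{x_1,\dots,x_s\}\subset(-\pi,\pi]$ and an integer $N\ge s-1$, $\mathbf{V}_N(\mathcal{X})$ is the $(N+1)\times s$ Vandermonde matrix $\mathbf{V}_N(\mathcal{X})=\bigl[e^{\imath k x_j}\bigr]_{0\le k\le N}^{1\le j\le s}$ (rows indexed by $k$, columns by $j$), and $\sigma_{\min}(\mathbf{V}_N(\mathcal{X}))=\min_{\mathbf{c}\in\mathbb{C}^s,\ \|\mathbf{c}\|_2=1}\|\mathbf{V}_N(\mathcal{X})\mathbf{c}\|_2$ is its smallest singular value. Wrap-around distance: for $x,y\in\mathbb{R}$, $d(x,y):=\bigl|\operatorname{Arg}\exp(\imath(x-y))\bigr|\in[0,\pi]$, where $\operatorname{Arg}$ is the principal argument with values in $(-\pi,\pi]$.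 A set $\mathcal{X}=\{x_1,\dots,x_s\}\subset(-\pi,\pi]$ of $s$ distinct nodes forms a $(\Delta,\theta,s,\ell,\tau)_{\mathbb{T}}$-clustered configuration, for some $\Delta>0$, integers $1\le\ell\le s$, $\ell-1\le\tau\le\frac{\pi}{\Delta}$ and $\theta>0$, if for each $x_j$ there exist at most $\ell$ distinct nodes $\mathcal{X}^{(j)}=\{x_{j,k}\}_{k=1,\dots,r_j}\subset\mathcal{X}$, $1\le r_j\le\ell$, $x_{j,1}=x_j$, such that: (1) for any $y\in\mathcal{X}^{(j)}\setminus\{x_j\}$, $\Delta\le d(y,x_j)\le\tau\Delta$; (2) for any $y\in\mathcal{X}\setminus\mathcal{X}^{(j)}$, $d(y,x_j)\ge\theta$. If $\tau=0$ (possible only for $\ell=1$), the upper bound on $N$ is read as no upper restriction. *)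

theory Defs
  imports "HOL-Analysis.Analysis" "Jordan_Normal_Form.Matrix"
begin

no_notation vec_nth (infixl "$" 90)

definition l2_norm :: "complex vec \<Rightarrow> real" where
  "l2_norm v = L2_set (\<lambda>i. cmod (v $ i)) {..<dim_vec v}"

text \<open>The minimum of the norms over the unit sphere is written as an infimum; lemma
  \<open>sigma_min_attained\<close> below shows that it is attained.\<close>

definition sigma_min :: "complex mat \<Rightarrow> real" where
  "sigma_min A = (INF c \<in> {c \<in> carrier_vec (dim_col A). l2_norm c = 1}. l2_norm (A *\<^sub>v c))"

lemma sigma_min_attained:
  assumes "dim_col A > 0"
  shows "\<exists>c \<in> carrier_vec (dim_col A). l2_norm c = 1 \<and> l2_norm (A *\<^sub>v c) = sigma_min A"
proof -
  define n where "n = dim_col A"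
  define K where "K = {c :: nat \<Rightarrow> complex. L2_set (\<lambda>i. cmod (c i)) {..<n} = 1}"
  define C where "C = Pi\<^sub>E (UNIV :: nat set) (\<lambda>_. cball (0::complex) 1)"
  define F where "F = (\<lambda>c :: nat \<Rightarrow> complex.
    L2_set (\<lambda>k. cmod (\<Sum>i<n. A $$ (k, i) * c i)) {..<dim_row A})"
  have "compactin (product_topology (\<lambda>_. euclidean) (UNIV :: nat set)) C"
    unfolding C_def by (subst compactin_PiE) auto
  then have C: "compact C"
    by (simp add: euclidean_product_topology)
  have contL: "continuous_on UNIV (\<lambda>c :: nat \<Rightarrow> complex. L2_set (\<lambda>i. cmod (c i)) {..<n})"
    unfolding L2_set_def by (intro continuous_intros continuous_on_product_coordinates)
  have contF: "continuous_on UNIV F"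
    unfolding L2_set_def F_def by (intro continuous_intros continuous_on_product_coordinates)
  have "closed K"
    unfolding K_def using contL by (intro closed_Collect_eq) auto
  then have comp: "compact (C \<inter> K)"
    using C by (rule compact_Int_closed[rotated])
  have delta: "(cmod (if i = 0 then 1 else 0))\<^sup>2 = (if i = 0 then 1 else 0)" for i :: nat
    by simp
  have e0: "(\<lambda>i. if i = 0 then 1 else 0) \<in> C \<inter> K"
    using assms unfolding C_def K_def n_def L2_set_def
    by (auto simp: delta)
  obtain c0 where c0: "c0 \<in> C \<inter> K" "\<And>c. c \<in> C \<inter> K \<Longrightarrow> F c0 \<le> F c"
    using continuous_attains_inf[OF comp _ continuous_on_subset[OF contF]] e0 by blast
  define u where "u = vec n c0"
  have app: "l2_norm (A *\<^sub>v v) = F (\<lambda>i. if i < n then v $ i else 0)"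
    if "v \<in> carrier_vec n" for v
    using that unfolding l2_norm_def F_def L2_set_def
    by (auto simp: scalar_prod_def n_def lessThan_atLeast0 row_def intro!: sum.cong arg_cong[where f = sqrt])
  have mem: "(\<lambda>i. if i < n then v $ i else 0) \<in> C \<inter> K"
    if v: "v \<in> carrier_vec n" "l2_norm v = 1" for v
  proof -
    have "cmod (v $ i) \<le> 1" if "i < n" for i
      using member_le_L2_set[of "{..<n}" i "\<lambda>i. cmod (v $ i)"] v that
      unfolding l2_norm_def by auto
    moreover have "L2_set (\<lambda>i. cmod (if i < n then v $ i else 0)) {..<n} = l2_norm v"
      using v unfolding l2_norm_def by (intro L2_set_cong) auto
    ultimately show ?thesis
      using v unfolding C_def K_def by auto
  qed
  have u: "u \<in> carrier_vec n" "l2_norm u = 1"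
    using c0(1) unfolding u_def l2_norm_def K_def by (auto simp: L2_set_def)
  have Fu: "l2_norm (A *\<^sub>v u) = F c0"
    unfolding app[OF u(1)] by (simp add: F_def u_def L2_set_def)
  have "sigma_min A = l2_norm (A *\<^sub>v u)"
    unfolding sigma_min_def
  proof (rule cInf_eq_minimum)
    show "l2_norm (A *\<^sub>v u)
        \<in> (\<lambda>c. l2_norm (A *\<^sub>v c)) ` {c \<in> carrier_vec (dim_col A). l2_norm c = 1}"
      using u unfolding n_def by blast
  next
    fix r
    assume "r \<in> (\<lambda>c. l2_norm (A *\<^sub>v c)) ` {c \<in> carrier_vec (dim_col A). l2_norm c = 1}"
    then obtain v where v: "v \<in> carrier_vec n" "l2_norm v = 1" "r = l2_norm (A *\<^sub>v v)"
      unfolding n_def by blast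
    show "l2_norm (A *\<^sub>v u) \<le> r"
      unfolding v(3) Fu app[OF v(1)] using v(1,2) by (intro c0(2) mem)
  qed
  then show ?thesis using u by (auto simp: n_def)
qed

definition vandermonde :: "nat \<Rightarrow> real list \<Rightarrow> complex mat" where
  "vandermonde N xs =
     mat (N + 1) (length xs) (\<lambda>(k, j). exp (\<i> * of_nat k * of_real (xs ! j)))"

definition wrap_dist :: "real \<Rightarrow> real \<Rightarrow> real" where
  "wrap_dist x y = \<bar>Arg (exp (\<i> * of_real (x - y)))\<bar>"

text \<open>The set \<open>Y\<close> plays the role of the cluster of \<open>x\<close>, with \<open>x\<close> itself included in it.\<close>

definition clustered_configuration ::
    "real \<Rightarrow> real \<Rightarrow> nat \<Rightarrow> nat \<Rightarrow> real \<Rightarrow> real set \<Rightarrow> bool" where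
  "clustered_configuration \<Delta> \<theta> s l \<tau> X \<longleftrightarrow>
     finite X \<and> X \<subseteq> {-pi<..pi} \<and> card X = s \<and>
     \<Delta> > 0 \<and> \<theta> > 0 \<and> 1 \<le> l \<and> l \<le> s \<and> real l - 1 \<le> \<tau> \<and> \<tau> \<le> pi / \<Delta> \<and>
     (\<forall>x\<in>X. \<exists>Y\<subseteq>X. x \<in> Y \<and> card Y \<le> l \<and>
        (\<forall>y\<in>Y - {x}. \<Delta> \<le> wrap_dist y x \<and> wrap_dist y x \<le> \<tau> * \<Delta>) \<and>
        (\<forall>y\<in>X - Y. \<theta> \<le> wrap_dist y x))"

end

theory Submission
  imports Defs
begin

text \<open>
  With \<open>z\<^sub>j = cis x\<^sub>j\<close>, the vector \<open>V\<^sub>N c\<close> lists the values at \<open>k = 0, \<dots>, N\<close> of the exponential sum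
  \<open>u k = (\<Sum>j. c\<^sub>j * z\<^sub>j ^ k)\<close>, and the theorem bounds its energy \<open>\<Sum>k\<le>N. \<bar>u k\<bar>\<^sup>2\<close> from below.
  Write \<open>\<parallel>u\<parallel>\<close> for the square root of the energy.
  The hypotheses on \<open>N\<close> make \<open>\<tau> * \<Delta>\<close> tiny compared with \<open>\<theta>\<close>, so that being closer than \<open>\<theta>\<close> is an
  equivalence relation whose classes, the clusters, have at most \<open>l\<close> nodes. Let \<open>u\<^sub>C\<close> be the part of
  \<open>u\<close> carried by the cluster \<open>C\<close>.

  All estimates come from one device. An exponential sum with nodes \<open>z\<^sub>j\<close>, sampled with step \<open>h\<close>,
  satisfies the linear recurrence whose characteristic polynomial has the roots \<open>z\<^sub>j ^ h\<close>. The
  coefficients of this polynomial have \<open>\<ell>\<^sup>1\<close> norm at most \<open>2 ^ n\<close>, where \<open>n\<close> is the number of nodes,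
  whatever the position of the nodes. The step \<open>h\<close> is free, and each estimate chooses it differently.

  Inside a cluster (\<open>single_cluster_bound\<close>) the step is about \<open>N / r\<close>, where \<open>r\<close> is the size of the
  cluster, and all roots but one are removed. The filtered sum is then the single term of \<open>c\<^sub>a\<close> times
  \<open>\<Prod>j\<noteq>a. (z\<^sub>a ^ h - z\<^sub>j ^ h)\<close>. Since \<open>N * \<tau> * \<Delta> \<le> 1\<close>, the factors are comparable with
  \<open>h\<close> times the distances from \<open>x\<^sub>a\<close> to the \<open>x\<^sub>j\<close>, and their product is at least
  \<open>(h * \<Delta> / 4) ^ (r - 1) * fact (r - 1)\<close> because the nodes are separated by \<open>\<Delta>\<close>. The factorial cancels the \<open>r ^ (r - 1)\<close> that stems from
  \<open>h \<approx> N / r\<close>, which leaves a loss that is only geometric in \<open>r\<close>.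

  Distinct clusters are almost orthogonal (\<open>cluster_inner_product_bound\<close>). The product of \<open>u\<^sub>C k\<close> with
  the conjugate of \<open>u\<^sub>D k\<close> is an exponential sum with at most \<open>l\<^sup>2\<close> nodes, all close to one point at
  angle at least \<open>\<theta>\<close> from \<open>1\<close>. A step \<open>m \<le> pi / \<theta>\<close> moves all nodes away from \<open>1\<close> by at least \<open>1\<close>, and
  then the recurrence shows that the sum over all \<open>k \<le> N\<close> is at most a constant times \<open>m\<close> times the
  largest term (\<open>oscillating_expsum_bound\<close>). The largest term is at most a constant times
  \<open>\<parallel>u\<^sub>C\<parallel> * \<parallel>u\<^sub>D\<parallel> / N\<close>: averaging the recurrence over many steps shows that no value of an exponential
  sum exceeds its root mean square by more than a constant factor (\<open>expsum_sup\<close>). So the inner product is at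
  most \<open>K l / (N * \<theta>) * \<parallel>u\<^sub>C\<parallel> * \<parallel>u\<^sub>D\<parallel>\<close>, which \<open>N * \<theta> \<ge> 2 * K l * s\<close> makes at most
  \<open>\<parallel>u\<^sub>C\<parallel> * \<parallel>u\<^sub>D\<parallel> / (2 * s)\<close>. There are at most \<open>s\<close> clusters, so the energy of \<open>u\<close> is at least half the
  sum of the energies of the \<open>u\<^sub>C\<close> (\<open>energy_sum_almost_orthogonal\<close>).
\<close>

section \<open>Annihilating filters for exponential sums\<close>

text \<open>
  Multiplying by \<open>x - w\<close> with \<open>\<bar>w\<bar> = 1\<close> at most doubles the \<open>\<ell>\<^sup>1\<close> norm of the coefficients and keeps
  the modulus of the constant term.
\<close>

lemma root_polynomial_coefficients:
  fixes w :: "'a \<Rightarrow> complex"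
  assumes "finite A" "\<And>j. j \<in> A \<Longrightarrow> norm (w j) = 1"
  shows "\<exists>q. (\<forall>x. (\<Prod>j\<in>A. x - w j) = (\<Sum>t\<le>card A. q t * x ^ t)) \<and>
    (\<Sum>t\<le>card A. norm (q t)) \<le> 2 ^ card A \<and> norm (q 0) = 1 \<and> (\<forall>t>card A. q t = 0)"
  using assms
proof (induction A rule: finite_induct)
  case empty
  show ?case by (rule exI[of _ "\<lambda>t. if t = 0 then 1 else 0"]) auto
next
  case (insert a A)
  then obtain q where q: "\<And>x. (\<Prod>j\<in>A. x - w j) = (\<Sum>t\<le>card A. q t * x ^ t)"
    "(\<Sum>t\<le>card A. norm (q t)) \<le> 2 ^ card A" "norm (q 0) = 1" "\<And>t. t > card A \<Longrightarrow> q t = 0"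
    by auto
  define n where "n = card A"
  have n: "card (insert a A) = Suc n" using insert by (simp add: n_def)
  have wa: "norm (w a) = 1" using insert by auto
  define q' where "q' = (\<lambda>t. (case t of 0 \<Rightarrow> 0 | Suc i \<Rightarrow> q i) - w a * q t)"
  have "(\<Prod>j\<in>insert a A. x - w j) = (\<Sum>t\<le>Suc n. q' t * x ^ t)" for x
  proof -
    have "(\<Sum>t\<le>Suc n. q' t * x ^ t) =
        (\<Sum>t\<le>Suc n. (case t of 0 \<Rightarrow> 0 | Suc i \<Rightarrow> q i) * x ^ t) - w a * (\<Sum>t\<le>Suc n. q t * x ^ t)"
      by (simp only: q'_def sum_subtractf left_diff_distrib sum_distrib_left mult.assoc)
    also have "(\<Sum>t\<le>Suc n. (case t of 0 \<Rightarrow> 0 | Suc i \<Rightarrow> q i) * x ^ t) = x * (\<Sum>t\<le>n. q t * x ^ t)"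
      by (subst sum.atMost_Suc_shift) (simp add: sum_distrib_left mult_ac)
    also have "(\<Sum>t\<le>Suc n. q t * x ^ t) = (\<Sum>t\<le>n. q t * x ^ t)"
      using q(4)[of "Suc n"] by (simp add: n_def)
    finally show ?thesis
      using insert q(1)[of x] by (simp add: n_def left_diff_distrib)
  qed
  moreover have "(\<Sum>t\<le>Suc n. norm (q' t)) \<le> 2 ^ Suc n"
  proof -
    have "(\<Sum>t\<le>Suc n. norm (q' t)) \<le>
        (\<Sum>t\<le>Suc n. norm (case t of 0 \<Rightarrow> 0 | Suc i \<Rightarrow> q i) + norm (q t))"
      unfolding q'_def using wa by (intro sum_mono order.trans[OF norm_triangle_ineq4]) (simp add: norm_mult)
    also have "\<dots> = (\<Sum>t\<le>n. norm (q t)) + (\<Sum>t\<le>n. norm (q t))"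
      unfolding sum.distrib using q(4)[of "Suc n"]
      by (subst sum.atMost_Suc_shift) (simp add: n_def)
    finally show ?thesis using q(2) by (simp add: n_def)
  qed
  moreover have "norm (q' 0) = 1" using q(3) wa by (simp add: q'_def norm_mult)
  moreover have "q' t = 0" if "t > Suc n" for t
    using that q(4) by (cases t) (auto simp: q'_def n_def)
  ultimately show ?case unfolding n by blast
qed

definition expsum :: "'a set \<Rightarrow> ('a \<Rightarrow> complex) \<Rightarrow> ('a \<Rightarrow> complex) \<Rightarrow> nat \<Rightarrow> complex" where
  "expsum A c z k = (\<Sum>j\<in>A. c j * z j ^ k)"

definition energy :: "nat \<Rightarrow> (nat \<Rightarrow> complex) \<Rightarrow> real" where
  "energy N u = (\<Sum>k\<le>N. (norm (u k))\<^sup>2)"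

lemma energy_nonneg: "energy N u \<ge> 0"
  unfolding energy_def by (intro sum_nonneg) auto

lemma sum_le_energy:
  assumes "inj_on g S" "finite S" "\<And>i. i \<in> S \<Longrightarrow> g i \<le> N"
  shows "(\<Sum>i\<in>S. (norm (u (g i)))\<^sup>2) \<le> energy N u"
proof -
  have "(\<Sum>i\<in>S. (norm (u (g i)))\<^sup>2) = (\<Sum>k\<in>g ` S. (norm (u k))\<^sup>2)"
    using assms by (simp add: sum.reindex)
  also have "\<dots> \<le> energy N u"
    unfolding energy_def using assms by (intro sum_mono2) auto
  finally show ?thesis .
qed

text \<open>
  A filter of step \<open>h\<close> multiplies the term of the node \<open>z\<^sub>j\<close> by its polynomial at \<open>z\<^sub>j ^ h\<close>. So the
  polynomial with roots \<open>z\<^sub>i ^ h\<close> deletes the terms of these nodes, for every \<open>h\<close>.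
\<close>

lemma filter_expsum:
  "(\<Sum>t\<in>T. q t * expsum A c z (k + t * h)) =
    (\<Sum>j\<in>A. c j * z j ^ k * (\<Sum>t\<in>T. q t * (z j ^ h) ^ t))"
  unfolding expsum_def sum_distrib_left
  by (subst sum.swap) (simp add: power_add mult_ac flip: power_mult)

lemma weighted_sum_norm_sq_le:
  fixes q v :: "'b \<Rightarrow> complex"
  assumes "finite T" "(\<Sum>t\<in>T. norm (q t)) \<le> K"
  shows "(norm (\<Sum>t\<in>T. q t * v t))\<^sup>2 \<le> K\<^sup>2 * (\<Sum>t\<in>T. (norm (v t))\<^sup>2)"
proof -
  have "norm (\<Sum>t\<in>T. q t * v t) \<le> (\<Sum>t\<in>T. norm (q t) * norm (v t))"
    by (rule sum_norm_le) (simp add: norm_mult)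
  then have "(norm (\<Sum>t\<in>T. q t * v t))\<^sup>2 \<le> (\<Sum>t\<in>T. norm (q t) * norm (v t))\<^sup>2"
    by (intro power_mono) auto
  also have "\<dots> \<le> (\<Sum>t\<in>T. (norm (q t))\<^sup>2) * (\<Sum>t\<in>T. (norm (v t))\<^sup>2)"
    by (rule Cauchy_Schwarz_ineq_sum)
  also have "\<dots> \<le> K\<^sup>2 * (\<Sum>t\<in>T. (norm (v t))\<^sup>2)"
  proof (rule mult_right_mono)
    have "L2_set (\<lambda>t. norm (q t)) T \<le> K"
      using L2_set_le_sum[of T "\<lambda>t. norm (q t)"] assms by simp
    then show "(\<Sum>t\<in>T. (norm (q t))\<^sup>2) \<le> K\<^sup>2"
      unfolding L2_set_def using sqrt_le_D by blast
  qed (simp add: sum_nonneg)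
  finally show ?thesis .
qed

text \<open>
  The filter that deletes all nodes except \<open>z\<^sub>a\<close> leaves a term of the same modulus for each \<open>k\<close>. Its
  windows \<open>k, k + h, \<dots>, k + (card A - 1) * h\<close> for \<open>k < h\<close> tile an initial part of \<open>{..N}\<close>, so summing
  the squares over \<open>k\<close> uses the energy only once and gains the factor \<open>h\<close>.
\<close>

lemma coefficient_bound:
  fixes z c :: "'a \<Rightarrow> complex"
  assumes A: "finite A" "a \<in> A" and z: "\<And>j. j \<in> A \<Longrightarrow> norm (z j) = 1"
    and h: "card A * h \<le> N + 1"
  shows "real h * (norm (c a) * (\<Prod>j\<in>A - {a}. norm (z a ^ h - z j ^ h)))\<^sup>2
    \<le> 4 ^ (card A - 1) * energy N (expsum A c z)"
proof -
  define n where "n = card (A - {a})"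
  have n: "card A = Suc n" using A unfolding n_def
    by (metis card.remove)
  obtain q where q: "\<And>x. (\<Prod>j\<in>A - {a}. x - z j ^ h) = (\<Sum>t\<le>n. q t * x ^ t)"
    "(\<Sum>t\<le>n. norm (q t)) \<le> 2 ^ n"
    using root_polynomial_coefficients[of "A - {a}" "\<lambda>j. z j ^ h"] A z
    unfolding n_def by (auto simp: norm_power)
  have flt: "norm (\<Sum>t\<le>n. q t * expsum A c z (k + t * h)) =
      norm (c a) * (\<Prod>j\<in>A - {a}. norm (z a ^ h - z j ^ h))" for k
  proof -
    have "(\<Sum>t\<le>n. q t * expsum A c z (k + t * h)) =
        (\<Sum>j\<in>A. c j * z j ^ k * (\<Prod>i\<in>A - {a}. z j ^ h - z i ^ h))"
      unfolding filter_expsum q(1) ..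
    also have "\<dots> = c a * z a ^ k * (\<Prod>i\<in>A - {a}. z a ^ h - z i ^ h)"
      using A by (subst sum.remove[of _ a]) (auto intro!: sum.neutral prod_zero)
    finally show ?thesis using z A by (simp add: norm_mult norm_power prod_norm)
  qed
  have "real h * (norm (c a) * (\<Prod>j\<in>A - {a}. norm (z a ^ h - z j ^ h)))\<^sup>2 =
      (\<Sum>k<h. (norm (\<Sum>t\<le>n. q t * expsum A c z (k + t * h)))\<^sup>2)"
    by (simp add: flt)
  also have "\<dots> \<le> (\<Sum>k<h. (2 ^ n)\<^sup>2 * (\<Sum>t\<le>n. (norm (expsum A c z (k + t * h)))\<^sup>2))"
    by (intro sum_mono weighted_sum_norm_sq_le q) auto
  also have "\<dots> = 4 ^ n * (\<Sum>t\<le>n. \<Sum>k<h. (norm (expsum A c z (k + t * h)))\<^sup>2)"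
    by (subst sum.swap) (simp add: sum_distrib_left power_mult[symmetric] mult.commute[of _ 2]
        power_mult[of 2 2])
  also have "(\<Sum>t\<le>n. \<Sum>k<h. (norm (expsum A c z (k + t * h)))\<^sup>2) =
      (\<Sum>k<card A * h. (norm (expsum A c z k))\<^sup>2)"
  proof -
    define f where "f = (\<lambda>k. (norm (expsum A c z k))\<^sup>2)"
    have "(\<Sum>k<h. f (k + t * h)) = sum f {t * h..<t * h + h}" for t
      using sum.shift_bounds_nat_ivl[of f 0 "t * h" h] by (simp add: lessThan_atLeast0 add.commute)
    then have "(\<Sum>t\<le>n. \<Sum>k<h. f (k + t * h)) = sum f {..<card A * h}"
      unfolding n by (simp only: sum.nat_group[symmetric] lessThan_Suc_atMost)
    then show ?thesis unfolding f_def .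
  qed
  also have "\<dots> \<le> energy N (expsum A c z)"
    unfolding energy_def using h by (intro sum_mono2) auto
  finally show ?thesis by (simp add: n)
qed

text \<open>
  The filter of step \<open>m\<close> that deletes all nodes has a constant term of modulus 1, hence bounds \<open>u k\<close>
  by the values \<open>u (k + t * m)\<close> with \<open>1 \<le> t \<le> card A\<close>. For fixed \<open>t\<close> these points are distinct as \<open>m\<close>
  varies, so the average over \<open>m \<le> M\<close> bounds \<open>u k\<close> by the energy divided by \<open>M\<close>.
\<close>

lemma expsum_local_sup:
  fixes z c :: "'a \<Rightarrow> complex"
  assumes A: "finite A" and z: "\<And>j. j \<in> A \<Longrightarrow> norm (z j) = 1"
    and M: "k + card A * M \<le> N"
  shows "real M * (norm (expsum A c z k))\<^sup>2 \<le> 4 ^ card A * real (card A) * energy N (expsum A c z)"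
proof -
  define r where "r = card A"
  define u where "u = expsum A c z"
  have one: "(norm (u k))\<^sup>2 \<le> 4 ^ r * (\<Sum>t\<in>{1..r}. (norm (u (k + t * m)))\<^sup>2)" for m
  proof -
    obtain q where q: "\<And>x. (\<Prod>j\<in>A. x - z j ^ m) = (\<Sum>t\<le>r. q t * x ^ t)"
      "(\<Sum>t\<le>r. norm (q t)) \<le> 2 ^ r" "norm (q 0) = 1"
      using root_polynomial_coefficients[of "A" "\<lambda>j. z j ^ m"] A z
      unfolding r_def by (auto simp: norm_power)
    have sp: "{..r} = insert 0 {1..r}" by auto
    have "(\<Sum>t\<le>r. q t * u (k + t * m)) = (\<Sum>j\<in>A. c j * z j ^ k * (\<Prod>i\<in>A. z j ^ m - z i ^ m))"
      unfolding u_def filter_expsum q(1) ..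
    also have "\<dots> = 0" using A by (auto intro!: sum.neutral prod_zero)
    finally have "q 0 * u k = - (\<Sum>t\<in>{1..r}. q t * u (k + t * m))"
      unfolding sp by (simp add: eq_neg_iff_add_eq_0)
    then have "norm (u k) = norm (\<Sum>t\<in>{1..r}. q t * u (k + t * m))"
      using q(3) by (metis mult_1 norm_minus_cancel norm_mult)
    also have "\<dots>\<^sup>2 \<le> (2 ^ r)\<^sup>2 * (\<Sum>t\<in>{1..r}. (norm (u (k + t * m)))\<^sup>2)"
      using q(2) q(3) unfolding sp by (intro weighted_sum_norm_sq_le) auto
    finally show ?thesis by (simp add: power_mult[symmetric] mult.commute[of _ 2] power_mult[of 2 2])
  qed
  have "real M * (norm (u k))\<^sup>2 = (\<Sum>m\<in>{1..M}. (norm (u k))\<^sup>2)" by simp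
  also have "\<dots> \<le> (\<Sum>m\<in>{1..M}. 4 ^ r * (\<Sum>t\<in>{1..r}. (norm (u (k + t * m)))\<^sup>2))"
    by (intro sum_mono one)
  also have "\<dots> = 4 ^ r * (\<Sum>t\<in>{1..r}. \<Sum>m\<in>{1..M}. (norm (u (k + t * m)))\<^sup>2)"
    by (subst sum.swap) (simp add: sum_distrib_left)
  also have "\<dots> \<le> 4 ^ r * (\<Sum>t\<in>{1..r}. energy N u)"
  proof (intro mult_left_mono sum_mono)
    fix t assume t: "t \<in> {1..r}"
    have "k + t * m \<le> N" if "m \<in> {1..M}" for m
      using M t that mult_mono[of t r m M] unfolding r_def by auto
    then show "(\<Sum>m\<in>{1..M}. (norm (u (k + t * m)))\<^sup>2) \<le> energy N u"
      using t by (intro sum_le_energy[where g = "\<lambda>m. k + t * m"]) (auto simp: inj_on_def)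
  qed auto
  finally show ?thesis by (simp add: r_def u_def mult.assoc)
qed

text \<open>
  No value exceeds the root mean square by more than a factor that depends on the number of nodes.
  The previous lemma only looks to the right of \<open>k\<close>. For \<open>k\<close> near \<open>N\<close> it is applied to the sum reversed by
  \<open>k \<mapsto> N - k\<close>, whose nodes are the conjugates.
\<close>

lemma expsum_sup:
  fixes z c :: "'a \<Rightarrow> complex"
  assumes A: "finite A" "A \<noteq> {}" and z: "\<And>j. j \<in> A \<Longrightarrow> norm (z j) = 1"
    and N: "2 * card A \<le> N" and k: "k \<le> N"
  shows "real N * (norm (expsum A c z k))\<^sup>2
    \<le> 4 ^ (card A + 1) * (real (card A))\<^sup>2 * energy N (expsum A c z)"
proof -
  define r where "r = card A"
  define M where "M = N div (2 * r)"
  have r: "r > 0" using A by (auto simp: r_def card_gt_0_iff)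
  \<comment> \<open>The reach \<open>r * M\<close> is at most \<open>N / 2\<close>, so it fits to the right or to the left of every \<open>k\<close>.\<close>
  have M1: "2 * (r * M) \<le> N" by (simp add: M_def mult.assoc[symmetric])
  have "M \<ge> 1" using N r unfolding M_def r_def by (simp add: div_greater_zero_iff Suc_leI)
  have "N < 2 * r * (M + 1)" unfolding M_def using r
    by (metis dividend_less_times_div mult_pos_pos pos2 add.commute mult.commute Suc_eq_plus1 mult_Suc_right)
  also have "\<dots> \<le> 2 * r * (2 * M)" using \<open>M \<ge> 1\<close> by (intro mult_left_mono) auto
  finally have "real N \<le> real (4 * r * M)" by (subst of_nat_le_iff) (simp add: mult_ac)
  then have M2: "real N \<le> 4 * real r * real M" by simp
  have "real M * (norm (expsum A c z k))\<^sup>2 \<le> 4 ^ r * real r * energy N (expsum A c z)"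
  proof (cases "k + r * M \<le> N")
    case True
    then show ?thesis using expsum_local_sup[of A z k M N c] A z by (simp add: r_def)
  next
    case False
    define c' where "c' = (\<lambda>j. c j * z j ^ N)"
    have reversed: "expsum A c z (N - i) = expsum A c' (\<lambda>j. cnj (z j)) i" if "i \<le> N" for i
      unfolding expsum_def
    proof (rule sum.cong[OF refl])
      fix j assume "j \<in> A"
      then have "z j * cnj (z j) = 1" using z by (simp add: complex_norm_square[symmetric])
      then have "z j ^ i * cnj (z j) ^ i = 1" by (metis power_mult_distrib power_one)
      moreover have "z j ^ N = z j ^ (N - i) * z j ^ i" using that by (simp add: power_add[symmetric])
      ultimately show "c j * z j ^ (N - i) = c' j * cnj (z j) ^ i"
        by (simp add: c'_def mult.assoc)
    qed
    have "energy N (expsum A c' (\<lambda>j. cnj (z j))) = energy N (expsum A c z)"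
      unfolding energy_def
      by (rule sum.reindex_bij_witness[of _ "\<lambda>i. N - i" "\<lambda>i. N - i"]) (auto simp: reversed)
    moreover have "N - k + r * M \<le> N" using False M1 k by linarith
    ultimately show ?thesis
      using expsum_local_sup[of A "\<lambda>j. cnj (z j)" "N - k" M N c'] A z reversed[of "N - k"] k
      by (simp add: r_def)
  qed
  then have "4 * real r * (real M * (norm (expsum A c z k))\<^sup>2) \<le>
      4 * real r * (4 ^ r * real r * energy N (expsum A c z))"
    by (intro mult_left_mono) auto
  moreover have "real N * (norm (expsum A c z k))\<^sup>2 \<le> 4 * real r * real M * (norm (expsum A c z k))\<^sup>2"
    using M2 by (intro mult_right_mono) auto
  ultimately show ?thesis by (simp add: r_def power2_eq_square mult_ac)
qed

text \<open>
  A filter that annihilates the sequence also annihilates its sums \<open>S t\<close> over the windows shifted by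
  \<open>t * m\<close>. Each \<open>S t\<close> is the full sum \<open>T\<close> up to \<open>card A * m\<close> edge terms. So \<open>T\<close> times the sum of the
  filter coefficients is controlled by edge terms alone, and the sum of the coefficients is
  \<open>\<Prod>j\<in>A. (1 - z\<^sub>j ^ m)\<close>, of modulus at least 1.
\<close>

lemma oscillating_expsum_bound:
  fixes z c :: "'a \<Rightarrow> complex"
  assumes A: "finite A" and z: "\<And>j. j \<in> A \<Longrightarrow> norm (z j) = 1"
    and m: "\<And>j. j \<in> A \<Longrightarrow> norm (1 - z j ^ m) \<ge> 1"
    and N: "card A * m \<le> N" and W: "\<And>k. k \<le> N \<Longrightarrow> norm (expsum A c z k) \<le> W"
  shows "norm (\<Sum>k\<le>N. expsum A c z k) \<le> 2 ^ card A * real (card A) * real m * W"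
proof -
  define n where "n = card A"
  define w where "w = expsum A c z"
  define T where "T = (\<Sum>k\<le>N. w k)"
  define S where "S = (\<lambda>t. \<Sum>k\<le>N - n * m. w (k + t * m))"
  obtain q where q: "\<And>x. (\<Prod>j\<in>A. x - z j ^ m) = (\<Sum>t\<le>n. q t * x ^ t)"
    "(\<Sum>t\<le>n. norm (q t)) \<le> 2 ^ n"
    using root_polynomial_coefficients[of "A" "\<lambda>j. z j ^ m"] A z
    unfolding n_def by (auto simp: norm_power)
  have "W \<ge> 0" using W[of 0] norm_ge_zero order_trans by blast
  have "(\<Sum>t\<le>n. q t * w (k + t * m)) = 0" for k
  proof -
    have "(\<Sum>t\<le>n. q t * w (k + t * m)) = (\<Sum>j\<in>A. c j * z j ^ k * (\<Prod>i\<in>A. z j ^ m - z i ^ m))"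
      unfolding w_def filter_expsum q(1) ..
    also have "\<dots> = 0" using A by (auto intro!: sum.neutral prod_zero)
    finally show ?thesis .
  qed
  then have "(\<Sum>k\<le>N - n * m. \<Sum>t\<le>n. q t * w (k + t * m)) = 0" by simp
  then have S0: "(\<Sum>t\<le>n. q t * S t) = 0"
    unfolding S_def sum_distrib_left by (subst sum.swap)
  have edge: "norm (T - S t) \<le> real (n * m) * W" if "t \<le> n" for t
  proof -
    define I where "I = (\<lambda>k. k + t * m) ` {..N - n * m}"
    have tm: "t * m \<le> n * m" using that by simp
    have I: "I \<subseteq> {..N}"
    proof
      fix i assume "i \<in> I"
      then obtain k where "i = k + t * m" "k \<le> N - n * m" unfolding I_def by auto
      moreover have "n * m \<le> N" using N by (simp add: n_def)
      ultimately have "i \<le> N" using tm by linarith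
      then show "i \<in> {..N}" by simp
    qed
    have cI: "card I = N - n * m + 1" unfolding I_def by (subst card_image) (auto simp: inj_on_def)
    have "S t = sum w I" unfolding S_def I_def by (subst sum.reindex) (auto simp: inj_on_def)
    then have "T - S t = sum w ({..N} - I)" unfolding T_def using I by (subst sum_diff) auto
    also have "norm \<dots> \<le> real (card ({..N} - I)) * W"
      using W unfolding w_def by (intro sum_norm_bound) auto
    also have "card ({..N} - I) = n * m"
      using I cI N by (subst card_Diff_subset) (auto intro: finite_subset simp: n_def)
    finally show ?thesis .
  qed
  have "1 \<le> (\<Prod>j\<in>A. norm (1 - z j ^ m))" using m by (intro prod_ge_1) auto
  also have "\<dots> = norm (\<Sum>t\<le>n. q t)" using q(1)[of 1] by (simp add: prod_norm)
  finally have "norm T \<le> norm (\<Sum>t\<le>n. q t) * norm T"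
    using mult_right_mono[of 1 "norm (\<Sum>t\<le>n. q t)" "norm T"] by simp
  also have "\<dots> = norm (\<Sum>t\<le>n. q t * (T - S t))"
    using S0 by (simp add: right_diff_distrib sum_subtractf sum_distrib_right norm_mult[symmetric])
  also have "\<dots> \<le> (\<Sum>t\<le>n. norm (q t) * (real (n * m) * W))"
    using edge by (intro sum_norm_le) (auto simp: norm_mult intro: mult_left_mono)
  also have "\<dots> \<le> 2 ^ n * (real (n * m) * W)"
    unfolding sum_distrib_right[symmetric] using q(2) \<open>W \<ge> 0\<close> by (intro mult_right_mono) auto
  finally show ?thesis by (simp add: T_def w_def n_def mult_ac)
qed

section \<open>The wrap-around distance and chords of the unit circle\<close>

lemma abs_Arg_cis_le: "\<bar>Arg (cis t)\<bar> \<le> \<bar>t\<bar>"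
proof (cases "\<bar>t\<bar> < pi")
  case True
  then show ?thesis by (subst Arg_cis) auto
next
  case False
  then show ?thesis using Arg_bounded[of "cis t"] by linarith
qed

lemma wrap_dist_cis: "wrap_dist x y = \<bar>Arg (cis (x - y))\<bar>"
  by (simp add: wrap_dist_def cis_conv_exp)

text \<open>
  The wrap-around distance is the least modulus of a representative of \<open>x - y\<close> modulo \<open>2 * pi\<close>.
\<close>

lemma wrap_dist_le: "cis t = cis (x - y) \<Longrightarrow> wrap_dist x y \<le> \<bar>t\<bar>"
  using abs_Arg_cis_le[of t] by (simp add: wrap_dist_cis)

lemma cis_Arg_cis: "cis (Arg (cis t)) = cis t"
  by (simp add: cis_Arg sgn_div_norm)

lemma cis_Arg_diff: "cis (Arg (cis s) - Arg (cis t)) = cis (s - t)"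
  by (simp add: cis_divide[symmetric] cis_Arg_cis)

lemma wrap_dist_self: "wrap_dist x x = 0"
  by (simp add: wrap_dist_cis)

lemma wrap_dist_commute: "wrap_dist x y = wrap_dist y x"
proof -
  have "wrap_dist y x \<le> wrap_dist x y" for x y
  proof -
    have "cis (- Arg (cis (x - y))) = cis (y - x)"
      by (metis cis_Arg_cis cis_inverse minus_diff_eq)
    then show ?thesis using wrap_dist_le by (simp add: wrap_dist_cis[of x y]) fastforce
  qed
  then show ?thesis by (meson order.antisym)
qed

lemma wrap_dist_triangle: "wrap_dist x w \<le> wrap_dist x y + wrap_dist y w"
proof -
  have "cis (Arg (cis (x - y)) + Arg (cis (y - w))) = cis (x - w)"
    by (simp add: cis_mult[symmetric] cis_Arg_cis) (simp add: cis_mult)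
  then have "wrap_dist x w \<le> \<bar>Arg (cis (x - y)) + Arg (cis (y - w))\<bar>"
    by (rule wrap_dist_le)
  then show ?thesis unfolding wrap_dist_cis[of x y] wrap_dist_cis[of y w] by linarith
qed

lemma norm_cis_minus_1: "norm (cis t - 1) = 2 * \<bar>sin (t / 2)\<bar>"
  using dist_exp_i_1[of t] by (simp add: cis_conv_exp)

lemma norm_cis_diff: "norm (cis a - cis b) = norm (cis (a - b) - 1)"
proof -
  have "cis a - cis b = cis b * (cis (a - b) - 1)"
    by (simp add: right_diff_distrib cis_mult)
  then show ?thesis by (simp add: norm_mult)
qed

lemma norm_cis_diff_le_wrap_dist: "norm (cis x - cis y) \<le> wrap_dist x y"
proof -
  have "norm (cis x - cis y) = norm (cis (Arg (cis (x - y))) - 1)"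
    by (simp add: norm_cis_diff cis_Arg_cis)
  also have "\<dots> \<le> wrap_dist x y"
    unfolding norm_cis_minus_1 wrap_dist_cis
    using abs_sin_x_le_abs_x[of "Arg (cis (x - y)) / 2"] by simp
  finally show ?thesis .
qed

lemma half_le_sin:
  fixes y :: real assumes "0 \<le> y" "y \<le> 1" shows "y / 2 \<le> sin y"
proof -
  \<comment> \<open>The slope of the sine on \<open>[0, 1]\<close> is at least \<open>cos (pi / 3) = 1 / 2\<close>.\<close>
  have "\<exists>t. 0 \<le> t \<and> t \<le> y \<and> sin y - sin 0 = (y - 0) * cos t"
  proof (cases "y = 0")
    case False
    then show ?thesis using assms MVT2[of 0 y sin cos] by (auto intro!: derivative_eq_intros) (metis less_imp_le)
  qed auto
  then obtain t where t: "0 \<le> t" "t \<le> y" "sin y = y * cos t" by auto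
  have "cos (pi / 3) \<le> cos t" using t assms pi_gt3 by (intro cos_monotone_0_pi_le) auto
  then have "y * (1 / 2) \<le> y * cos t" using assms by (intro mult_left_mono) (auto simp: cos_60)
  then show ?thesis using t by simp
qed

lemma chord_lower_bound:
  assumes "\<bar>t\<bar> \<le> 1" shows "\<bar>t\<bar> / 2 \<le> norm (cis t - 1)"
proof -
  have "\<bar>sin (t / 2)\<bar> \<ge> sin \<bar>t / 2\<bar>" by (cases "t \<ge> 0") auto
  then show ?thesis
    using half_le_sin[of "\<bar>t / 2\<bar>"] assms unfolding norm_cis_minus_1 by simp
qed

text \<open>
  The least multiple of \<open>\<bar>t\<bar>\<close> that reaches \<open>pi / 2\<close> does not exceed \<open>pi\<close>, and points of the unit circle
  with nonpositive real part are at distance at least \<open>sqrt 2\<close> from 1.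
\<close>

lemma exists_power_far_from_1:
  assumes "0 < \<theta>" "\<theta> \<le> \<bar>t\<bar>" "\<bar>t\<bar> \<le> pi"
  shows "\<exists>m. real m * \<theta> \<le> pi \<and> norm (1 - cis t ^ m) \<ge> sqrt 2"
proof -
  have t: "\<bar>t\<bar> > 0" using assms by simp
  define m where "m = nat \<lceil>pi / 2 / \<bar>t\<bar>\<rceil>"
  have m1: "pi / 2 \<le> real m * \<bar>t\<bar>"
    using mult_right_mono[OF real_nat_ceiling_ge[of "pi / 2 / \<bar>t\<bar>"], of "\<bar>t\<bar>"] t
    by (simp add: m_def)
  have m2: "real m * \<bar>t\<bar> \<le> pi"
  proof (cases "pi / 2 \<le> \<bar>t\<bar>")
    case True
    have "m \<le> 1" unfolding m_def using True t by (simp add: ceiling_le_iff field_simps)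
    then show ?thesis using assms mult_right_mono[of "real m" 1 "\<bar>t\<bar>"] by simp
  next
    case False
    have "0 \<le> pi / 2 / \<bar>t\<bar>" by simp
    then have "real m < pi / 2 / \<bar>t\<bar> + 1" unfolding m_def by linarith
    then have "real m * \<bar>t\<bar> < (pi / 2 / \<bar>t\<bar> + 1) * \<bar>t\<bar>" using t by (intro mult_strict_right_mono)
    also have "\<dots> = pi / 2 + \<bar>t\<bar>" using t by (simp add: field_simps)
    finally show ?thesis using False by simp
  qed
  have "cos (real m * t) = cos (real m * \<bar>t\<bar>)" by (cases "t \<ge> 0") auto
  also have "\<dots> \<le> cos (pi / 2)" using m1 m2 by (intro cos_monotone_0_pi_le) auto
  finally have cs: "cos (real m * t) \<le> 0" by simp
  have "(norm (1 - cis t ^ m))\<^sup>2 = (1 - cos (real m * t))\<^sup>2 + (sin (real m * t))\<^sup>2"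
    by (simp add: Complex.DeMoivre cmod_power2)
  also have "\<dots> = 2 - 2 * cos (real m * t)"
    using sin_cos_squared_add[of "real m * t"] by (simp add: power2_eq_square algebra_simps)
  finally have "2 \<le> (norm (1 - cis t ^ m))\<^sup>2" using cs by simp
  then have "sqrt 2 \<le> norm (1 - cis t ^ m)" by (simp add: real_le_lsqrt)
  moreover have "real m * \<theta> \<le> pi" using m2 mult_left_mono[OF assms(2), of "real m"] by simp
  ultimately show ?thesis by blast
qed

section \<open>Products of separated real numbers\<close>

text \<open>
  In increasing order, the \<open>i\<close>-th element is at least \<open>i * d\<close>. The induction removes the maximum; the
  second conjunct of the strengthened claim is the bound for the next element.
\<close>

lemma prod_separated_pos:
  fixes P :: "real set"
  assumes "finite P" "d > 0" "\<And>p. p \<in> P \<Longrightarrow> d \<le> p"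
    "\<And>p q. p \<in> P \<Longrightarrow> q \<in> P \<Longrightarrow> p \<noteq> q \<Longrightarrow> d \<le> \<bar>p - q\<bar>"
  shows "d ^ card P * fact (card P) \<le> \<Prod>P"
proof -
  have "d ^ card P * fact (card P) \<le> \<Prod>P \<and>
    (\<forall>b. d \<le> b \<and> (\<forall>p\<in>P. p + d \<le> b) \<longrightarrow> real (card P + 1) * d \<le> b)"
    using assms
  proof (induction P rule: finite_linorder_max_induct)
    case (insert b A)
    have b: "d \<le> b" "\<And>p. p \<in> A \<Longrightarrow> p + d \<le> b"
    proof -
      show "p + d \<le> b" if "p \<in> A" for p
        using insert(2) that insert.prems(3)[of p b] by fastforce
    qed (use insert in auto)
    have IH: "d ^ card A * fact (card A) \<le> \<Prod>A"
      "\<And>b. d \<le> b \<Longrightarrow> (\<forall>p\<in>A. p + d \<le> b) \<Longrightarrow> real (card A + 1) * d \<le> b"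
      using insert by auto
    have nb: "b \<notin> A" using insert(2) by auto
    have cd: "card (insert b A) = Suc (card A)" using insert nb by simp
    have bd: "real (card A + 1) * d \<le> b" using IH(2)[of b] b by auto
    have "(real (card A + 1) * d) * (d ^ card A * fact (card A)) \<le> b * \<Prod>A"
      using bd IH(1) b(1) insert.prems(1) by (intro mult_mono) auto
    moreover have "real (Suc (card (insert b A))) * d \<le> b'" if "\<forall>p\<in>insert b A. p + d \<le> b'" for b'
      using that bd unfolding cd by (auto simp: algebra_simps)
    ultimately show ?case using nb insert(1) by (auto simp: cd mult_ac)
  qed auto
  then show ?thesis by blast
qed

text \<open>
  Positive and negative elements are treated separately; if there are \<open>a\<close> and \<open>b\<close> of them, then
  \<open>a! * b!\<close> differs from \<open>(a + b)!\<close> by a binomial coefficient, which is at most \<open>2 ^ (a + b)\<close>.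
\<close>

lemma prod_separated:
  fixes P :: "real set"
  assumes P: "finite P" "d > 0" "\<And>p. p \<in> P \<Longrightarrow> d \<le> \<bar>p\<bar>"
    "\<And>p q. p \<in> P \<Longrightarrow> q \<in> P \<Longrightarrow> p \<noteq> q \<Longrightarrow> d \<le> \<bar>p - q\<bar>"
  shows "(d / 2) ^ card P * fact (card P) \<le> (\<Prod>p\<in>P. \<bar>p\<bar>)"
proof -
  define A where "A = {p \<in> P. p > 0}"
  define B where "B = uminus ` {p \<in> P. p \<le> 0}"
  have fin: "finite A" "finite B" using P unfolding A_def B_def by auto
  have sp: "P = A \<union> {p \<in> P. p \<le> 0}" "A \<inter> {p \<in> P. p \<le> 0} = {}" unfolding A_def by auto
  have cB: "card B = card {p \<in> P. p \<le> 0}" unfolding B_def by (intro card_image) (auto simp: inj_on_def)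
  then have c: "card P = card A + card B"
    using sp fin P(1) by (metis (no_types, lifting) card_Un_disjoint finite_Un)
  have "(\<Prod>p\<in>P. \<bar>p\<bar>) = (\<Prod>p\<in>A. \<bar>p\<bar>) * (\<Prod>p\<in>{p \<in> P. p \<le> 0}. \<bar>p\<bar>)"
    using sp P(1) by (subst sp(1), intro prod.union_disjoint) (auto simp: A_def)
  also have "(\<Prod>p\<in>A. \<bar>p\<bar>) = \<Prod>A" by (rule prod.cong) (auto simp: A_def)
  also have "(\<Prod>p\<in>{p \<in> P. p \<le> 0}. \<bar>p\<bar>) = \<Prod>B"
    unfolding B_def by (subst prod.reindex) (auto simp: inj_on_def intro!: prod.cong)
  finally have pr: "(\<Prod>p\<in>P. \<bar>p\<bar>) = \<Prod>A * \<Prod>B" .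
  have pA: "d ^ card A * fact (card A) \<le> \<Prod>A"
    using P fin by (intro prod_separated_pos) (auto simp: A_def, force)
  have pB: "d ^ card B * fact (card B) \<le> \<Prod>B"
  proof (rule prod_separated_pos[OF fin(2) P(2)])
    show "d \<le> p" if "p \<in> B" for p using that P(3) by (force simp: B_def)
    show "d \<le> \<bar>p - q\<bar>" if pq: "p \<in> B" "q \<in> B" "p \<noteq> q" for p q
      using pq P(4)[of "-p" "-q"] by (auto simp: B_def)
  qed
  have f: "fact (card P) / 2 ^ card P \<le> (fact (card A) * fact (card B) :: real)"
  proof -
    have "fact (card P) = fact (card A) * fact (card B) * real (card P choose card A)"
      using binomial_fact_lemma[of "card A" "card P"] unfolding c
      by (metis add_diff_cancel_left' le_add1 of_nat_fact of_nat_mult)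
    also have "\<dots> \<le> fact (card A) * fact (card B) * 2 ^ card P"
    proof (intro mult_left_mono)
      have "card P choose card A \<le> 2 ^ card P" by (rule binomial_le_pow2)
      then have "real (card P choose card A) \<le> real (2 ^ card P)" by (rule of_nat_mono)
      then show "real (card P choose card A) \<le> 2 ^ card P" by simp
    qed auto
    finally show ?thesis by (simp add: field_simps)
  qed
  have "(d / 2) ^ card P * fact (card P) = d ^ card P * (fact (card P) / 2 ^ card P)"
    by (simp add: power_divide)
  also have "\<dots> \<le> d ^ card P * (fact (card A) * fact (card B))"
    using f P(2) by (intro mult_left_mono) auto
  also have "\<dots> = (d ^ card A * fact (card A)) * (d ^ card B * fact (card B))"
    by (simp add: c power_add mult_ac)
  also have "\<dots> \<le> \<Prod>A * \<Prod>B"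
    using pA pB P(2) by (intro mult_mono order.trans[OF _ pA]) auto
  finally show ?thesis unfolding pr .
qed

text \<open>
  The left-hand side over \<open>fact n\<close> is one term of the series of \<open>exp n\<close>.
\<close>

lemma power_self_le_exp_fact: "real n ^ n \<le> exp 1 ^ n * fact n"
proof -
  have "real n ^ n / fact n \<le> (\<Sum>k. real n ^ k /\<^sub>R fact k)"
    using sum_le_suminf[OF summable_exp_generic[of "real n"], of "{n}"] 
    by (simp add: divide_inverse mult.commute)
  also have "\<dots> = exp 1 ^ n" 
    using exp_of_nat_mult[of n "1::real"] by (simp add: exp_def)
  finally show ?thesis by (simp add: field_simps)
qed

section \<open>Coefficients within one cluster\<close>

text \<open>
  The step \<open>h = N div card A\<close> is, up to rounding, the largest for which the filter of length \<open>card A\<close> fits. On a cluster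
  of angular width at most \<open>1 / N\<close> the map \<open>z \<mapsto> z ^ h\<close> stretches distances by about \<open>h\<close>, so
  \<open>coefficient_bound\<close> controls each coefficient through a product of the node distances.
\<close>

lemma single_cluster_bound:
  fixes x :: "'a \<Rightarrow> real" and c :: "'a \<Rightarrow> complex"
  assumes A: "finite A" "A \<noteq> {}" and N: "card A \<le> N" "real N * \<rho> \<le> 1" and \<Delta>: "\<Delta> > 0"
    and sep: "\<And>i j. i \<in> A \<Longrightarrow> j \<in> A \<Longrightarrow> i \<noteq> j \<Longrightarrow> \<Delta> \<le> wrap_dist (x i) (x j)"
    and diam: "\<And>i j. i \<in> A \<Longrightarrow> j \<in> A \<Longrightarrow> wrap_dist (x i) (x j) \<le> \<rho>"
  shows "real N * ((real N * \<Delta>) ^ (card A - 1))\<^sup>2 * (\<Sum>j\<in>A. (norm (c j))\<^sup>2)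
    \<le> 2 * (exp 1)\<^sup>2 * ((32 * exp 1) ^ (card A - 1))\<^sup>2 * energy N (expsum A c (\<lambda>j. cis (x j)))"
proof -
  define r where "r = card A"
  define n where "n = r - 1"
  define h where "h = N div r"
  define E where "E = energy N (expsum A c (\<lambda>j. cis (x j)))"
  have E0: "E \<ge> 0" unfolding E_def by (rule energy_nonneg)
  have r: "r > 0" "r = Suc n" using A by (auto simp: r_def n_def card_gt_0_iff)
  have h1: "r * h \<le> N" unfolding h_def by simp
  have "h \<ge> 1" using N r unfolding h_def r_def by (simp add: div_greater_zero_iff Suc_leI)
  have h2: "real N \<le> 2 * real r * real h"
  proof -
    have "N = r * h + N mod r" unfolding h_def by simp
    moreover have "N mod r < r" using r by simp
    moreover have "r \<le> r * h" using \<open>h \<ge> 1\<close> by simp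
    ultimately have "N \<le> 2 * (r * h)" by linarith
    then have "real N \<le> real (2 * (r * h))" by (rule of_nat_mono)
    then show ?thesis by simp
  qed
  have "h \<le> N" using h_def by simp
  have one: "real N * ((real N * \<Delta>) ^ n)\<^sup>2 * (norm (c a))\<^sup>2
      \<le> 2 * real r * (exp 1)\<^sup>2 * ((16 * exp 1) ^ n)\<^sup>2 * E" if a: "a \<in> A" for a
  proof -
    \<comment> \<open>Angles relative to \<open>x a\<close> unroll the cluster from the circle to the real line.\<close>
    define \<delta> where "\<delta> = (\<lambda>j. Arg (cis (x j - x a)))"
    have cd: "cis (\<delta> j) = cis (x j - x a)" for j unfolding \<delta>_def by (rule cis_Arg_cis)
    have \<delta>_abs: "\<bar>\<delta> j\<bar> = wrap_dist (x j) (x a)" for j unfolding \<delta>_def wrap_dist_cis ..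
    have \<delta>_sep: "\<Delta> \<le> \<bar>\<delta> i - \<delta> j\<bar>" if "i \<in> A" "j \<in> A" "i \<noteq> j" for i j
    proof -
      have "cis (\<delta> i - \<delta> j) = cis (x i - x j)"
        unfolding \<delta>_def by (simp add: cis_Arg_diff)
      then show ?thesis using sep[OF that] wrap_dist_le by fastforce
    qed
    have inj: "inj_on \<delta> (A - {a})"
      using \<delta>_sep \<Delta> by (intro inj_onI) fastforce
    have card: "card (\<delta> ` (A - {a})) = n"
      unfolding card_image[OF inj] using A a r by (simp add: r_def)
    have "(\<Delta> / 2) ^ card (\<delta> ` (A - {a})) * fact (card (\<delta> ` (A - {a}))) \<le> (\<Prod>p\<in>\<delta> ` (A - {a}). \<bar>p\<bar>)"
      using A \<Delta> sep a \<delta>_sep by (intro prod_separated) (auto simp: \<delta>_abs)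
    then have pr: "(\<Delta> / 2) ^ n * fact n \<le> (\<Prod>j\<in>A - {a}. \<bar>\<delta> j\<bar>)"
      unfolding card by (subst (asm) prod.reindex[OF inj]) simp
    have chord: "real h / 2 * \<bar>\<delta> j\<bar> \<le> norm (cis (x a) ^ h - cis (x j) ^ h)" if "j \<in> A - {a}" for j
    proof -
      have eq: "cis (real h * x j - real h * x a) = cis (real h * \<delta> j)"
        by (metis Complex.DeMoivre cd right_diff_distrib)
      have "\<bar>real h * \<delta> j\<bar> \<le> real N * \<rho>"
        unfolding abs_mult \<delta>_abs using \<open>h \<le> N\<close> diam[of j a] a that
        by (intro mult_mono) (auto simp: wrap_dist_cis)
      then have "\<bar>real h * \<delta> j\<bar> / 2 \<le> norm (cis (real h * \<delta> j) - 1)"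
        using N by (intro chord_lower_bound) auto
      also have "\<dots> = norm (cis (x a) ^ h - cis (x j) ^ h)"
        unfolding Complex.DeMoivre by (subst norm_minus_commute) (simp add: norm_cis_diff eq)
      finally show ?thesis by (simp add: abs_mult)
    qed
    have "(real h * \<Delta> / 4) ^ n * fact n = (real h / 2) ^ n * ((\<Delta> / 2) ^ n * fact n)"
      by (simp add: power_mult_distrib[symmetric])
    also have "\<dots> \<le> (real h / 2) ^ n * (\<Prod>j\<in>A - {a}. \<bar>\<delta> j\<bar>)"
      using pr by (intro mult_left_mono) auto
    also have "\<dots> = (\<Prod>j\<in>A - {a}. real h / 2 * \<bar>\<delta> j\<bar>)"
      unfolding prod.distrib using A a r by (simp add: r_def)
    also have "\<dots> \<le> (\<Prod>j\<in>A - {a}. norm (cis (x a) ^ h - cis (x j) ^ h))"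
      using chord by (intro prod_mono) auto
    finally have P: "(real h * \<Delta> / 4) ^ n * fact n \<le>
      (\<Prod>j\<in>A - {a}. norm (cis (x a) ^ h - cis (x j) ^ h))" .
    have "real h * (norm (c a) * ((real h * \<Delta> / 4) ^ n * fact n))\<^sup>2 \<le>
        real h * (norm (c a) * (\<Prod>j\<in>A - {a}. norm (cis (x a) ^ h - cis (x j) ^ h)))\<^sup>2"
      using P \<Delta> by (intro mult_left_mono power_mono) auto
    also have "\<dots> \<le> 4 ^ n * E"
      using coefficient_bound[OF A(1) a, of "\<lambda>j. cis (x j)" h N c] h1
      by (simp add: E_def r_def n_def)
    finally have main: "real h * (norm (c a) * ((real h * \<Delta> / 4) ^ n * fact n))\<^sup>2 \<le> 4 ^ n * E" .
    have "real N * ((real N * \<Delta>) ^ n)\<^sup>2 * (norm (c a))\<^sup>2 * (fact n)\<^sup>2 \<le>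
        (2 * real r * real h) * ((2 * real r * real h * \<Delta>) ^ n)\<^sup>2 * (norm (c a))\<^sup>2 * (fact n)\<^sup>2"
      using h2 \<Delta> by (intro mult_right_mono mult_mono power_mono) auto
    also have "\<dots> = 2 * real r * ((8 * real r) ^ n)\<^sup>2 *
        (real h * (norm (c a) * ((real h * \<Delta> / 4) ^ n * fact n))\<^sup>2)"
    proof -
      have "(2 * real r * real h * \<Delta>) ^ n = (8 * real r * (real h * \<Delta> / 4)) ^ n"
        by (rule arg_cong[where f = "\<lambda>y. y ^ n"]) simp
      also have "\<dots> = (8 * real r) ^ n * (real h * \<Delta> / 4) ^ n" by (rule power_mult_distrib)
      finally have "(2 * real r * real h * \<Delta>) ^ n = (8 * real r) ^ n * (real h * \<Delta> / 4) ^ n" .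
      moreover have "(2 * p * q) * (X * Y)\<^sup>2 * v\<^sup>2 * f\<^sup>2 = 2 * p * X\<^sup>2 * (q * (v * (Y * f))\<^sup>2)"
        for p q X Y v f :: real
        by (simp add: power2_eq_square)
      ultimately show ?thesis by (simp only:)
    qed
    also have "\<dots> \<le> 2 * real r * ((8 * real r) ^ n)\<^sup>2 * (4 ^ n * E)"
      using main by (intro mult_left_mono) auto
    also have "\<dots> = 2 * real r * E * (16 ^ n * real r ^ n)\<^sup>2"
    proof -
      have "(8 ^ n)\<^sup>2 * 4 ^ n = ((16 ^ n)\<^sup>2 :: real)"
        by (simp add: power_mult[symmetric] mult.commute[of n] power_mult[of _ 2] power_mult_distrib[symmetric])
      then show ?thesis by (simp add: power_mult_distrib mult_ac)
    qed
    \<comment> \<open>With \<open>r = n + 1\<close>, \<open>r ^ n / n!\<close> equals \<open>r ^ r / r!\<close>, which is at most \<open>exp 1 ^ r\<close>.\<close>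
    also have "\<dots> \<le> 2 * real r * E * (16 ^ n * (exp 1 * exp 1 ^ n * fact n))\<^sup>2"
    proof -
      have "real r ^ n * real r \<le> (exp 1 * exp 1 ^ n * fact n) * real r"
        using power_self_le_exp_fact[of r] unfolding r(2) by (simp add: mult_ac)
      then have "real r ^ n \<le> exp 1 * exp 1 ^ n * fact n"
        using r(1) by (simp del: of_nat_Suc)
      then show ?thesis using E0 by (intro mult_left_mono power_mono) auto
    qed
    finally have "(real N * ((real N * \<Delta>) ^ n)\<^sup>2 * (norm (c a))\<^sup>2) * (fact n)\<^sup>2 \<le>
        (2 * real r * (exp 1)\<^sup>2 * ((16 * exp 1) ^ n)\<^sup>2 * E) * (fact n)\<^sup>2"
      by (simp add: power_mult_distrib mult_ac)
    then show ?thesis by (rule mult_right_le_imp_le) simp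
  qed
  have "real N * ((real N * \<Delta>) ^ n)\<^sup>2 * (\<Sum>j\<in>A. (norm (c j))\<^sup>2) \<le>
      (\<Sum>j\<in>A. 2 * real r * (exp 1)\<^sup>2 * ((16 * exp 1) ^ n)\<^sup>2 * E)"
    unfolding sum_distrib_left by (intro sum_mono one)
  also have "\<dots> = (real r)\<^sup>2 * (2 * (exp 1)\<^sup>2 * ((16 * exp 1) ^ n)\<^sup>2 * E)"
    by (simp add: r_def power2_eq_square)
  \<comment> \<open>The sum over \<open>j\<close> and the factor \<open>r\<close> of each term cost \<open>r\<^sup>2\<close>, which is absorbed into the geometric rate.\<close>
  also have "\<dots> \<le> (2 ^ n)\<^sup>2 * (2 * (exp 1)\<^sup>2 * ((16 * exp 1) ^ n)\<^sup>2 * E)"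
  proof (intro mult_right_mono power_mono)
    have "Suc n \<le> 2 ^ n" by (simp add: Suc_leI)
    then have "real (Suc n) \<le> real (2 ^ n)" by (rule of_nat_mono)
    then show "real r \<le> 2 ^ n" unfolding r(2) by simp
  qed (use E0 in auto)
  also have "\<dots> = 2 * (exp 1)\<^sup>2 * (2 ^ n * (16 * exp 1) ^ n)\<^sup>2 * E"
    by (simp add: power_mult_distrib mult_ac)
  also have "2 ^ n * (16 * exp 1) ^ n = (2 * (16 * exp 1) :: real) ^ n"
    by (rule power_mult_distrib[symmetric])
  finally show ?thesis by (simp add: E_def n_def r_def mult.assoc)
qed

section \<open>Almost orthogonality of distinct clusters\<close>

text \<open>
  The constant \<open>K l\<close> of the bound \<open>K l / (N * \<theta>) * \<parallel>u\<^sub>C\<parallel> * \<parallel>u\<^sub>D\<parallel>\<close> for the inner product of two clusters.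
  The factors \<open>2 ^ (l\<^sup>2) * l\<^sup>2\<close> come from \<open>oscillating_expsum_bound\<close> for \<open>l\<^sup>2\<close> nodes, \<open>pi\<close> from the step
  \<open>m \<le> pi / \<theta>\<close>, and the last one from \<open>expsum_sup\<close> for the two clusters.
\<close>

definition crosstalk :: "nat \<Rightarrow> real" where
  "crosstalk l = 2 ^ (l\<^sup>2) * real (l\<^sup>2) * pi * (4 ^ (l + 1) * (real l)\<^sup>2)"

lemma crosstalk_ge:
  assumes "l \<ge> 1" shows "32 * pi * real (l\<^sup>2) \<le> crosstalk l"
proof -
  have "2 ^ 1 \<le> (2 ^ (l\<^sup>2) :: real)" using assms by (intro power_increasing) auto
  moreover have "4 ^ 2 \<le> (4 ^ (l + 1) :: real)" using assms by (intro power_increasing) auto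
  moreover have "1 \<le> (real l)\<^sup>2" using assms by simp
  ultimately have "(2 * 16 * 1) * (real (l\<^sup>2) * pi) \<le>
      (2 ^ (l\<^sup>2) * 4 ^ (l + 1) * (real l)\<^sup>2) * (real (l\<^sup>2) * pi)"
    by (intro mult_right_mono mult_mono) auto
  then show ?thesis by (simp add: crosstalk_def mult_ac)
qed

text \<open>
  The terms of the inner product form an exponential sum with the nodes \<open>\<zeta> (i, j) = cis (x i - x j)\<close>.
  One step \<open>m\<close> serves all of them: it is chosen for a single pair, and as \<open>m * \<rho>\<close> is small the powers
  \<open>\<zeta> (i, j) ^ m\<close> of the other pairs stay close to it.
\<close>

lemma cluster_inner_product_bound:
  fixes x :: "'a \<Rightarrow> real" and c :: "'a \<Rightarrow> complex"
  assumes A: "finite A" "A \<noteq> {}" "card A \<le> l" and B: "finite B" "B \<noteq> {}" "card B \<le> l"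
    and N: "2 * l \<le> N" "real N * \<rho> \<le> 1" "crosstalk l \<le> real N * \<theta>" and \<theta>: "\<theta> > 0"
    and far: "\<And>i j. i \<in> A \<Longrightarrow> j \<in> B \<Longrightarrow> \<theta> \<le> wrap_dist (x i) (x j)"
    and diamA: "\<And>i j. i \<in> A \<Longrightarrow> j \<in> A \<Longrightarrow> wrap_dist (x i) (x j) \<le> \<rho>"
    and diamB: "\<And>i j. i \<in> B \<Longrightarrow> j \<in> B \<Longrightarrow> wrap_dist (x i) (x j) \<le> \<rho>"
  defines "u \<equiv> expsum A c (\<lambda>j. cis (x j))" and "v \<equiv> expsum B c (\<lambda>j. cis (x j))"
  shows "norm (\<Sum>k\<le>N. u k * cnj (v k))
    \<le> crosstalk l / (real N * \<theta>) * (sqrt (energy N u) * sqrt (energy N v))"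
proof -
  have l: "l \<ge> 1" using A card_gt_0_iff[of A] by linarith
  then have N0: "N > 0" using N(1) by linarith
  define K where "K = 4 ^ (l + 1) * (real l)\<^sup>2"
  have sup: "norm (expsum C c (\<lambda>j. cis (x j)) k) \<le>
      sqrt (K / real N) * sqrt (energy N (expsum C c (\<lambda>j. cis (x j))))"
    if C: "finite C" "C \<noteq> {}" "card C \<le> l" and k: "k \<le> N" for C k
  proof -
    have "real N * (norm (expsum C c (\<lambda>j. cis (x j)) k))\<^sup>2 \<le>
        4 ^ (card C + 1) * (real (card C))\<^sup>2 * energy N (expsum C c (\<lambda>j. cis (x j)))"
      using C k N by (intro expsum_sup) auto
    also have "\<dots> \<le> K * energy N (expsum C c (\<lambda>j. cis (x j)))"
      unfolding K_def using C energy_nonneg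
      by (intro mult_right_mono mult_mono power_mono power_increasing) auto
    finally have "(norm (expsum C c (\<lambda>j. cis (x j)) k))\<^sup>2 \<le>
        K / real N * energy N (expsum C c (\<lambda>j. cis (x j)))"
      using N0 by (simp add: field_simps)
    then show ?thesis unfolding real_sqrt_mult[symmetric] by (rule real_le_rsqrt)
  qed
  define \<zeta> where "\<zeta> = (\<lambda>(i, j). cis (x i - x j))"
  define W where "W = K / real N * (sqrt (energy N u) * sqrt (energy N v))"
  have W0: "W \<ge> 0" unfolding W_def K_def by (simp add: energy_nonneg)
  have prod_eq: "u k * cnj (v k) = expsum (A \<times> B) (\<lambda>(i, j). c i * cnj (c j)) \<zeta> k" for k
  proof -
    have power: "cis (x i) ^ k * cnj (cis (x j) ^ k) = cis (x i - x j) ^ k" for i j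
      unfolding Complex.DeMoivre by (simp add: cis_cnj cis_mult right_diff_distrib)
    have "u k * cnj (v k) = (\<Sum>i\<in>A. \<Sum>j\<in>B. (c i * cis (x i) ^ k) * cnj (c j * cis (x j) ^ k))"
      unfolding u_def v_def expsum_def by (simp only: cnj_sum sum_product)
    also have "\<dots> = (\<Sum>i\<in>A. \<Sum>j\<in>B. c i * cnj (c j) * cis (x i - x j) ^ k)"
      unfolding power[symmetric] by (simp only: complex_cnj_mult mult_ac)
    also have "\<dots> = expsum (A \<times> B) (\<lambda>(i, j). c i * cnj (c j)) \<zeta> k"
      unfolding expsum_def \<zeta>_def by (simp add: sum.cartesian_product case_prod_unfold)
    finally show ?thesis .
  qed
  have bound: "norm (expsum (A \<times> B) (\<lambda>(i, j). c i * cnj (c j)) \<zeta> k) \<le> W" if "k \<le> N" for k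
  proof -
    have "norm (u k * cnj (v k)) \<le>
        (sqrt (K / real N) * sqrt (energy N u)) * (sqrt (K / real N) * sqrt (energy N v))"
      unfolding norm_mult using sup[OF A that] sup[OF B that] unfolding u_def v_def
      by (intro mult_mono) (auto simp: K_def energy_nonneg)
    also have "\<dots> = (sqrt (K / real N) * sqrt (K / real N)) * (sqrt (energy N u) * sqrt (energy N v))"
      by (simp only: mult_ac)
    also have "\<dots> = W" unfolding W_def by (subst real_sqrt_mult_self) (simp add: K_def)
    finally show ?thesis by (simp add: prod_eq)
  qed
  obtain i0 j0 where ij: "i0 \<in> A" "j0 \<in> B" using A B by auto
  define t where "t = Arg (cis (x i0 - x j0))"
  have ct: "cis t = cis (x i0 - x j0)" unfolding t_def by (rule cis_Arg_cis)
  have "\<theta> \<le> \<bar>t\<bar>" using far[OF ij] by (simp add: t_def wrap_dist_cis)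
  moreover have "\<bar>t\<bar> \<le> pi" unfolding t_def using Arg_bounded[of "cis (x i0 - x j0)"] by linarith
  ultimately obtain m where m: "real m * \<theta> \<le> pi" "sqrt 2 \<le> norm (1 - cis t ^ m)"
    using exists_power_far_from_1[OF \<theta>, of t] by auto
  have ctl: "32 * pi * real (l\<^sup>2) \<le> real N * \<theta>" using crosstalk_ge[OF l] N by linarith
  have m_small: "32 * real (l\<^sup>2) * real m \<le> real N"
  proof -
    have "(32 * real (l\<^sup>2) * real m) * \<theta> = 32 * real (l\<^sup>2) * (real m * \<theta>)" by simp
    also have "\<dots> \<le> 32 * real (l\<^sup>2) * pi" using m by (intro mult_left_mono) auto
    also have "\<dots> \<le> real N * \<theta>" using ctl by (simp add: mult_ac)
    finally show ?thesis using \<theta> by simp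
  qed
  have far1: "1 \<le> norm (1 - \<zeta> p ^ m)" if p: "p \<in> A \<times> B" for p
  proof -
    obtain i j where p_eq: "p = (i, j)" "i \<in> A" "j \<in> B" using p by auto
    have "norm (\<zeta> p - cis t) \<le> wrap_dist (x i - x j) (x i0 - x j0)"
      unfolding ct \<zeta>_def p_eq by (simp add: norm_cis_diff_le_wrap_dist)
    also have "\<dots> \<le> \<bar>Arg (cis (x i - x i0)) - Arg (cis (x j - x j0))\<bar>"
      by (rule wrap_dist_le) (simp add: cis_Arg_diff algebra_simps)
    also have "\<dots> \<le> \<rho> + \<rho>"
      using diamA[of i i0] diamB[of j j0] ij p_eq unfolding wrap_dist_cis by linarith
    finally have near: "norm (\<zeta> p - cis t) \<le> 2 * \<rho>" by simp
    have "norm (\<zeta> p ^ m - cis t ^ m) \<le> real m * norm (\<zeta> p - cis t)"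
      by (rule norm_power_diff) (auto simp: \<zeta>_def p_eq)
    also have "\<dots> \<le> real m * (2 * \<rho>)" using near by (intro mult_left_mono) auto
    also have "\<dots> \<le> 1 / 16"
    proof -
      have "\<rho> \<ge> 0" using diamA[OF ij(1) ij(1)] by (simp add: wrap_dist_self)
      have "1 \<le> real (l\<^sup>2)" using l by simp
      then have "32 * real m \<le> real N"
        using m_small mult_right_mono[of 1 "real (l\<^sup>2)" "32 * real m"] by (simp add: mult_ac)
      then have "32 * real m * \<rho> \<le> real N * \<rho>" using \<open>\<rho> \<ge> 0\<close> by (rule mult_right_mono)
      then show ?thesis using N(2) by linarith
    qed
    finally have "norm (\<zeta> p ^ m - cis t ^ m) \<le> 1 / 16" .
    moreover have "norm (1 - cis t ^ m) \<le> norm (1 - \<zeta> p ^ m) + norm (\<zeta> p ^ m - cis t ^ m)"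
      using norm_triangle_ineq[of "1 - \<zeta> p ^ m" "\<zeta> p ^ m - cis t ^ m"] by simp
    \<comment> \<open>The distance \<open>sqrt 2\<close> leaves room for the perturbation \<open>1 / 16\<close> above the required distance 1.\<close>
    moreover have "sqrt 2 \<ge> 17 / 16" by (rule real_le_rsqrt) (simp add: power2_eq_square)
    ultimately show ?thesis using m(2) by linarith
  qed
  have cAB: "card (A \<times> B) \<le> l\<^sup>2"
    using A B by (simp add: card_cartesian_product power2_eq_square mult_mono)
  have "card (A \<times> B) * m \<le> N"
  proof -
    have "real (card (A \<times> B) * m) \<le> real (l\<^sup>2 * m)" using cAB by (intro of_nat_mono mult_right_mono) auto
    also have "\<dots> \<le> real N" using m_small by simp
    finally show ?thesis by (simp only: of_nat_le_iff)
  qed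
  then have "norm (\<Sum>k\<le>N. expsum (A \<times> B) (\<lambda>(i, j). c i * cnj (c j)) \<zeta> k) \<le>
      2 ^ card (A \<times> B) * real (card (A \<times> B)) * real m * W"
    using A B far1 bound by (intro oscillating_expsum_bound) (auto simp: \<zeta>_def)
  also have "\<dots> \<le> 2 ^ (l\<^sup>2) * real (l\<^sup>2) * (pi / \<theta>) * W"
    using cAB m \<theta> W0 by (intro mult_right_mono mult_mono power_increasing) (auto simp: field_simps simp del: card_cartesian_product of_nat_power)
  also have "\<dots> = crosstalk l / (real N * \<theta>) * (sqrt (energy N u) * sqrt (energy N v))"
    by (simp add: crosstalk_def W_def K_def mult_ac)
  finally show ?thesis by (simp add: prod_eq)
qed

text \<open>
  By Cauchy-Schwarz, the off-diagonal inner products together are at most \<open>\<eta> * card I\<close> times the sum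
  of the energies.
\<close>

lemma energy_sum_almost_orthogonal:
  fixes u :: "'b \<Rightarrow> nat \<Rightarrow> complex"
  assumes I: "finite I" and \<eta>: "\<eta> \<ge> 0" "\<eta> * real (card I) \<le> 1 / 2"
    and ip: "\<And>C D. C \<in> I \<Longrightarrow> D \<in> I \<Longrightarrow> C \<noteq> D \<Longrightarrow> norm (\<Sum>k\<le>N. u C k * cnj (u D k))
      \<le> \<eta> * (sqrt (energy N (u C)) * sqrt (energy N (u D)))"
  shows "(\<Sum>C\<in>I. energy N (u C)) \<le> 2 * energy N (\<lambda>k. \<Sum>C\<in>I. u C k)"
proof -
  define a where "a = (\<lambda>C. sqrt (energy N (u C)))"
  have a0: "a C \<ge> 0" for C unfolding a_def by (simp add: energy_nonneg)
  have a2: "(a C)\<^sup>2 = energy N (u C)" for C unfolding a_def by (simp add: energy_nonneg)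
  have en: "complex_of_real (energy N v) = (\<Sum>k\<le>N. v k * cnj (v k))" for v
    unfolding energy_def of_real_sum by (simp only: complex_norm_square)
  have "complex_of_real (energy N (\<lambda>k. \<Sum>C\<in>I. u C k)) =
      (\<Sum>C\<in>I. \<Sum>D\<in>I. \<Sum>k\<le>N. u C k * cnj (u D k))"
    unfolding en by (simp add: sum_product sum.swap[of _ _ "{..N}"])
  also have "\<dots> = (\<Sum>C\<in>I. complex_of_real (energy N (u C)) +
      (\<Sum>D\<in>I - {C}. \<Sum>k\<le>N. u C k * cnj (u D k)))"
    unfolding en using I by (intro sum.cong refl) (simp add: sum.remove)
  finally have eq: "complex_of_real (energy N (\<lambda>k. \<Sum>C\<in>I. u C k) - (\<Sum>C\<in>I. energy N (u C))) =
      (\<Sum>C\<in>I. \<Sum>D\<in>I - {C}. \<Sum>k\<le>N. u C k * cnj (u D k))"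
    by (simp add: sum.distrib)
  have "\<bar>energy N (\<lambda>k. \<Sum>C\<in>I. u C k) - (\<Sum>C\<in>I. energy N (u C))\<bar> =
      norm (\<Sum>C\<in>I. \<Sum>D\<in>I - {C}. \<Sum>k\<le>N. u C k * cnj (u D k))"
    unfolding eq[symmetric] norm_of_real ..
  also have "\<dots> \<le> (\<Sum>C\<in>I. \<Sum>D\<in>I - {C}. \<eta> * (a C * a D))"
    unfolding a_def by (intro sum_norm_le ip) auto
  also have "\<dots> \<le> (\<Sum>C\<in>I. \<Sum>D\<in>I. \<eta> * (a C * a D))"
    using I a0 \<eta> by (intro sum_mono sum_mono2) auto
  also have "\<dots> = \<eta> * (\<Sum>C\<in>I. a C)\<^sup>2"
    unfolding power2_eq_square sum_product by (simp add: sum_distrib_left)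
  also have "\<dots> \<le> \<eta> * (real (card I) * (\<Sum>C\<in>I. (a C)\<^sup>2))"
    using sum_squared_le_sum_of_squares[of a I] I \<eta> by (intro mult_left_mono) (auto simp: mult.commute)
  also have "\<dots> \<le> 1 / 2 * (\<Sum>C\<in>I. (a C)\<^sup>2)"
    unfolding mult.assoc[symmetric] using \<eta> by (intro mult_right_mono sum_nonneg) auto
  finally show ?thesis unfolding a2 by linarith
qed


section \<open>Clustered configurations\<close>

text \<open>
  The clusters are the classes of \<open>wrap_dist (x i) (x j) < \<theta>\<close>, which is transitive since two nodes at
  distance below \<open>\<theta>\<close> are at distance at most \<open>\<rho>\<close>, and \<open>2 * \<rho> < \<theta>\<close>. As \<open>N * \<Delta> \<le> 1\<close> when \<open>l \<ge> 2\<close>,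
  clusters with fewer than \<open>l\<close> nodes only satisfy a better bound.
\<close>

lemma clustered_energy_bound:
  fixes x :: "'a \<Rightarrow> real" and c :: "'a \<Rightarrow> complex"
  assumes J: "finite J" and l: "1 \<le> l" "l \<le> card J"
    and pos: "\<Delta> > 0" "\<theta> > 0" "\<theta> \<le> pi" "\<rho> \<ge> 0"
    and N: "real N * \<rho> \<le> 1" "2 * crosstalk l * real (card J) \<le> real N * \<theta>"
      "l \<ge> 2 \<Longrightarrow> real N * \<Delta> \<le> 1"
    and clusters: "\<And>i. i \<in> J \<Longrightarrow> \<exists>Y\<subseteq>J. card Y \<le> l \<and>
      (\<forall>j\<in>Y - {i}. \<Delta> \<le> wrap_dist (x j) (x i) \<and> wrap_dist (x j) (x i) \<le> \<rho>) \<and>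
      (\<forall>j\<in>J - Y. \<theta> \<le> wrap_dist (x j) (x i))"
  shows "real N * ((real N * \<Delta>) ^ (l - 1))\<^sup>2 * (\<Sum>j\<in>J. (norm (c j))\<^sup>2)
    \<le> 4 * (exp 1)\<^sup>2 * ((32 * exp 1) ^ (l - 1))\<^sup>2 * energy N (expsum J c (\<lambda>j. cis (x j)))"
proof -
  define u where "u = (\<lambda>C. expsum C c (\<lambda>j. cis (x j)))"
  have ct: "32 * pi * real (l\<^sup>2) \<le> crosstalk l" by (rule crosstalk_ge[OF l(1)])
  have ct2: "32 * pi \<le> crosstalk l"
  proof -
    have "1 \<le> real (l\<^sup>2)" using l by simp
    then have "32 * pi * 1 \<le> 32 * pi * real (l\<^sup>2)" by (intro mult_left_mono) auto
    then show ?thesis using ct by linarith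
  qed
  have ct0: "crosstalk l > 0" using ct2 pi_gt_zero by linarith
  have cJ: "1 \<le> real (card J)" using l by simp
  have N2: "2 * crosstalk l \<le> real N * \<theta>"
    using N(2) mult_left_mono[OF cJ, of "2 * crosstalk l"] ct0 by linarith
  have N0: "N > 0" using N2 ct0 by (intro gr0I) auto
  have Nl: "2 * l \<le> N"
  proof -
    have "(2 * real l) * pi \<le> 2 * crosstalk l * real (card J)"
    proof -
      have "pi \<le> crosstalk l" "0 \<le> crosstalk l" using ct2 pi_gt_zero by linarith+
      then have "pi * real l \<le> crosstalk l * real (card J)"
        using l by (intro mult_mono) auto
      then show ?thesis by (simp add: mult_ac)
    qed
    also have "\<dots> \<le> real N * pi" using N(2) mult_left_mono[OF pos(3), of "real N"] by linarith
    finally show ?thesis by simp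
  qed
  have two\<rho>: "2 * \<rho> < \<theta>"
  proof -
    have "real N * (2 * \<rho>) < real N * \<theta>" using N(1) N2 ct2 pi_gt3 by linarith
    then show ?thesis using N0 by simp
  qed
  have near: "wrap_dist (x i) (x j) \<le> \<rho> \<and> (i \<noteq> j \<longrightarrow> \<Delta> \<le> wrap_dist (x i) (x j))"
    if ij: "i \<in> J" "j \<in> J" "wrap_dist (x i) (x j) < \<theta>" for i j
  proof (cases "i = j")
    case False
    obtain Y where Y: "\<forall>i\<in>Y - {j}. \<Delta> \<le> wrap_dist (x i) (x j) \<and> wrap_dist (x i) (x j) \<le> \<rho>"
      "\<forall>i\<in>J - Y. \<theta> \<le> wrap_dist (x i) (x j)"
      using clusters[OF ij(2)] by blast
    have "i \<in> Y" using Y(2) ij by force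
    then show ?thesis using Y(1) False by blast
  qed (use pos(4) in \<open>simp add: wrap_dist_self\<close>)
  define R where "R = {(i, j). i \<in> J \<and> j \<in> J \<and> wrap_dist (x i) (x j) < \<theta>}"
  have "equiv J R"
  proof (rule equivI)
    show "R \<subseteq> J \<times> J" by (auto simp: R_def)
    show "refl_on J R" using pos by (auto simp: R_def refl_on_def wrap_dist_self)
    show "sym R" by (auto simp: R_def sym_def wrap_dist_commute)
    show "trans R"
    proof (rule transI)
      fix i j k assume ij: "(i, j) \<in> R" and jk: "(j, k) \<in> R"
      then have "wrap_dist (x i) (x j) \<le> \<rho>" "wrap_dist (x j) (x k) \<le> \<rho>"
        using near by (auto simp: R_def)
      then have "wrap_dist (x i) (x k) < \<theta>"
        using wrap_dist_triangle[of "x i" "x k" "x j"] two\<rho> by linarith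
      then show "(i, k) \<in> R" using ij jk by (auto simp: R_def)
    qed
  qed
  define \<C> where "\<C> = J // R"
  have Un: "\<Union>\<C> = J" unfolding \<C>_def by (rule Union_quotient) fact
  have disj: "C \<inter> D = {}" if "C \<in> \<C>" "D \<in> \<C>" "C \<noteq> D" for C D
    using quotient_disj[OF \<open>equiv J R\<close>] that unfolding \<C>_def by blast
  have sub: "C \<subseteq> J" "finite C" if "C \<in> \<C>" for C
    using Un that J by (auto intro: finite_subset)
  have ne: "C \<noteq> {}" if "C \<in> \<C>" for C
    using in_quotient_imp_non_empty[OF \<open>equiv J R\<close>] that unfolding \<C>_def by blast
  have inR: "(i, j) \<in> R" if "C \<in> \<C>" "i \<in> C" "j \<in> C" for C i j
    using quotient_eq_iff[OF \<open>equiv J R\<close>] that unfolding \<C>_def by blast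
  have notR: "\<theta> \<le> wrap_dist (x i) (x j)" if "C \<in> \<C>" "D \<in> \<C>" "C \<noteq> D" "i \<in> C" "j \<in> D" for C D i j
  proof (rule ccontr)
    assume "\<not> \<theta> \<le> wrap_dist (x i) (x j)"
    then have "(i, j) \<in> R" using that sub by (auto simp: R_def)
    then show False
      using quotient_eq_iff[OF \<open>equiv J R\<close>] that unfolding \<C>_def by blast
  qed
  have diam: "wrap_dist (x i) (x j) \<le> \<rho>" if "C \<in> \<C>" "i \<in> C" "j \<in> C" for C i j
    using inR[OF that] near[of i j] by (auto simp: R_def)
  have card: "card C \<le> l" if C: "C \<in> \<C>" for C
  proof -
    obtain i where i: "i \<in> C" using ne[OF C] by auto
    then obtain Y where Y: "Y \<subseteq> J" "card Y \<le> l" "\<forall>j\<in>J - Y. \<theta> \<le> wrap_dist (x j) (x i)"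
      using clusters sub(1)[OF C] by blast
    have "C \<subseteq> Y"
    proof
      fix j assume "j \<in> C"
      then have "j \<in> J" "wrap_dist (x j) (x i) < \<theta>" using inR[OF C _ i] by (auto simp: R_def)
      then show "j \<in> Y" using Y(3) by force
    qed
    then show ?thesis using Y J by (meson card_mono finite_subset order.trans)
  qed
  have finC: "finite \<C>" "card \<C> \<le> card J"
    using J unfolding \<C>_def quotient_def UNION_singleton_eq_range
    by (auto intro: card_image_le)
  have split: "sum g J = (\<Sum>C\<in>\<C>. sum g C)" for g :: "'a \<Rightarrow> 'b::comm_monoid_add"
    using sum.Union_disjoint[of \<C> g] sub disj unfolding Un by auto
  have almost: "(\<Sum>C\<in>\<C>. energy N (u C)) \<le> 2 * energy N (\<lambda>k. \<Sum>C\<in>\<C>. u C k)"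
  proof (rule energy_sum_almost_orthogonal[OF finC(1), where \<eta> = "crosstalk l / (real N * \<theta>)"])
    show "0 \<le> crosstalk l / (real N * \<theta>)" using ct0 pos by simp
    have "crosstalk l * real (card \<C>) \<le> crosstalk l * real (card J)"
      using finC ct0 by (intro mult_left_mono) auto
    then have "crosstalk l * real (card \<C>) \<le> real N * \<theta> / 2" using N(2) by linarith
    then show "crosstalk l / (real N * \<theta>) * real (card \<C>) \<le> 1 / 2"
      using N0 pos by (simp add: field_simps)
    fix C D assume CD: "C \<in> \<C>" "D \<in> \<C>" "C \<noteq> D"
    show "norm (\<Sum>k\<le>N. u C k * cnj (u D k))
        \<le> crosstalk l / (real N * \<theta>) * (sqrt (energy N (u C)) * sqrt (energy N (u D)))"
      unfolding u_def
    proof (rule cluster_inner_product_bound[where \<rho> = \<rho>])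
      show "crosstalk l \<le> real N * \<theta>" using N2 ct0 by linarith
      show "\<theta> \<le> wrap_dist (x i) (x j)" if "i \<in> C" "j \<in> D" for i j
        by (rule notR[OF CD that])
      show "wrap_dist (x i) (x j) \<le> \<rho>" if "i \<in> C" "j \<in> C" for i j
        by (rule diam[OF CD(1) that])
      show "wrap_dist (x i) (x j) \<le> \<rho>" if "i \<in> D" "j \<in> D" for i j
        by (rule diam[OF CD(2) that])
    qed (rule sub(2)[OF CD(1)] ne[OF CD(1)] card[OF CD(1)] sub(2)[OF CD(2)] ne[OF CD(2)]
        card[OF CD(2)] Nl N(1) pos(2))+
  qed
  have J_eq: "(\<lambda>k. \<Sum>C\<in>\<C>. u C k) = expsum J c (\<lambda>j. cis (x j))"
    unfolding u_def expsum_def by (rule ext) (rule split[symmetric])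
  have each: "real N * ((real N * \<Delta>) ^ (l - 1))\<^sup>2 * (\<Sum>j\<in>C. (norm (c j))\<^sup>2)
      \<le> 2 * (exp 1)\<^sup>2 * ((32 * exp 1) ^ (l - 1))\<^sup>2 * energy N (u C)" if C: "C \<in> \<C>" for C
  proof -
    have le: "card C - 1 \<le> l - 1" using card[OF C] by simp
    have "(real N * \<Delta>) ^ (l - 1) \<le> (real N * \<Delta>) ^ (card C - 1)"
    proof (cases "l \<ge> 2")
      case True
      then show ?thesis using N(3) pos le by (intro power_decreasing) auto
    qed (use le in simp)
    then have "real N * ((real N * \<Delta>) ^ (l - 1))\<^sup>2 * (\<Sum>j\<in>C. (norm (c j))\<^sup>2) \<le>
        real N * ((real N * \<Delta>) ^ (card C - 1))\<^sup>2 * (\<Sum>j\<in>C. (norm (c j))\<^sup>2)"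
      using pos by (intro mult_right_mono mult_left_mono power_mono) (auto simp: sum_nonneg)
    also have "\<dots> \<le> 2 * (exp 1)\<^sup>2 * ((32 * exp 1) ^ (card C - 1))\<^sup>2 * energy N (u C)"
      unfolding u_def
    proof (rule single_cluster_bound[where \<rho> = \<rho>])
      show "card C \<le> N" using card[OF C] Nl by linarith
      show "\<Delta> \<le> wrap_dist (x i) (x j)" if "i \<in> C" "j \<in> C" "i \<noteq> j" for i j
        using inR[OF C that(1,2)] near[of i j] that(3) by (auto simp: R_def)
    qed (rule sub(2)[OF C] ne[OF C] N(1) pos(1) diam[OF C] | assumption)+
    also have "\<dots> \<le> 2 * (exp 1)\<^sup>2 * ((32 * exp 1) ^ (l - 1))\<^sup>2 * energy N (u C)"
    proof -
      have "1 \<le> 32 * exp (1::real)" using exp_ge_add_one_self[of 1] by linarith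
      then show ?thesis
        using le energy_nonneg
        by (intro mult_right_mono mult_left_mono power_mono power_increasing) auto
    qed
    finally show ?thesis .
  qed
  have "real N * ((real N * \<Delta>) ^ (l - 1))\<^sup>2 * (\<Sum>j\<in>J. (norm (c j))\<^sup>2) =
      (\<Sum>C\<in>\<C>. real N * ((real N * \<Delta>) ^ (l - 1))\<^sup>2 * (\<Sum>j\<in>C. (norm (c j))\<^sup>2))"
    unfolding split by (rule sum_distrib_left)
  also have "\<dots> \<le> (\<Sum>C\<in>\<C>. 2 * (exp 1)\<^sup>2 * ((32 * exp 1) ^ (l - 1))\<^sup>2 * energy N (u C))"
    by (intro sum_mono each)
  also have "\<dots> = 2 * (exp 1)\<^sup>2 * ((32 * exp 1) ^ (l - 1))\<^sup>2 * (\<Sum>C\<in>\<C>. energy N (u C))"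
    by (simp only: sum_distrib_left)
  also have "\<dots> \<le> 2 * (exp 1)\<^sup>2 * ((32 * exp 1) ^ (l - 1))\<^sup>2 *
      (2 * energy N (expsum J c (\<lambda>j. cis (x j))))"
    using almost unfolding J_eq by (intro mult_left_mono) auto
  finally show ?thesis by simp
qed

lemma energy_vandermonde:
  assumes "c \<in> carrier_vec (length xs)"
  shows "energy N (expsum {..<length xs} (\<lambda>j. c $ j) (\<lambda>j. cis (xs ! j)))
    = (l2_norm (vandermonde N xs *\<^sub>v c))\<^sup>2"
proof -
  have "(vandermonde N xs *\<^sub>v c) $ k = expsum {..<length xs} (\<lambda>j. c $ j) (\<lambda>j. cis (xs ! j)) k"
    if "k < N + 1" for k
  proof -
    have "exp (\<i> * of_nat k * of_real y) = cis y ^ k" for y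
      unfolding Complex.DeMoivre by (simp add: cis_conv_exp mult.assoc)
    then show ?thesis
      using that assms
      by (auto simp: vandermonde_def expsum_def scalar_prod_def lessThan_atLeast0
          intro!: sum.cong mult.commute)
  qed
  moreover have "dim_vec (vandermonde N xs *\<^sub>v c) = N + 1" by (simp add: vandermonde_def)
  ultimately show ?thesis
    by (simp add: l2_norm_def L2_set_def energy_def sum_nonneg lessThan_Suc_atMost[symmetric])
qed

theorem theorem2p2:
  shows "\<exists>(C4 :: nat \<Rightarrow> real) (C5 :: nat \<Rightarrow> real) (C7 :: real).
    (\<forall>l\<ge>1. C4 l > 0 \<and> C5 l > 0) \<and> C7 > 0 \<and>
    (let C6 = 32 * pi * exp 1 in
     \<forall>(xs :: real list) (\<Delta> :: real) (\<theta> :: real) (s :: nat) (l :: nat) (\<tau> :: real) (N :: nat).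
       distinct xs \<and> clustered_configuration \<Delta> \<theta> s l \<tau> (set xs) \<and> \<theta> \<le> pi \<and>
       s \<le> N + 1 \<and>
       C4 l * real s / \<theta> \<le> real N \<and>
       (\<tau> \<noteq> 0 \<longrightarrow> real N \<le> C5 l / (real s * \<tau> * \<Delta>)) \<longrightarrow>
       sigma_min (vandermonde N xs) \<ge> C7 * sqrt (real N) * (real N * \<Delta> / C6) ^ (l - 1))"
proof -
  \<comment> \<open>\<open>1 / (2 * exp 1)\<close> is the inverse square root of the factor \<open>4 * (exp 1)\<^sup>2\<close> of \<open>clustered_energy_bound\<close>;
      its rate \<open>32 * exp 1\<close> is better than the claimed one, since \<open>pi \<ge> 1\<close>.\<close>
  have main: "1 / (2 * exp 1) * sqrt (real N) * (real N * \<Delta> / (32 * pi * exp 1)) ^ (l - 1)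
      \<le> sigma_min (vandermonde N xs)"
    if xs: "distinct xs" and cc: "clustered_configuration \<Delta> \<theta> s l \<tau> (set xs)" and "\<theta> \<le> pi"
      and N1: "2 * crosstalk l * real s / \<theta> \<le> real N"
      and N2: "\<tau> \<noteq> 0 \<longrightarrow> real N \<le> 1 / (real s * \<tau> * \<Delta>)"
    for xs \<Delta> \<theta> s l \<tau> N
  proof -
    have s: "length xs = s" and pos: "\<Delta> > 0" "\<theta> > 0" and l: "1 \<le> l" "l \<le> s" and \<tau>: "real l - 1 \<le> \<tau>"
      and cl: "\<And>y. y \<in> set xs \<Longrightarrow> \<exists>Y\<subseteq>set xs. y \<in> Y \<and> card Y \<le> l \<and>
        (\<forall>z\<in>Y - {y}. \<Delta> \<le> wrap_dist z y \<and> wrap_dist z y \<le> \<tau> * \<Delta>) \<and>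
        (\<forall>z\<in>set xs - Y. \<theta> \<le> wrap_dist z y)"
      using cc distinct_card[OF xs] unfolding clustered_configuration_def by auto
    have \<tau>0: "\<tau> \<ge> 0" using \<tau> l by linarith
    have N\<rho>: "real N * (\<tau> * \<Delta>) \<le> 1"
    proof (cases "\<tau> = 0")
      case False
      have s1: "1 \<le> real s" using l by simp
      have p: "0 < \<tau> * \<Delta>" using False \<tau>0 pos by simp
      then have "0 < real s * \<tau> * \<Delta>" using s1 by (simp add: mult.assoc)
      then have "real N * (real s * \<tau> * \<Delta>) \<le> 1" using N2 False by (simp add: field_simps)
      moreover have "real N * (\<tau> * \<Delta>) * 1 \<le> real N * (\<tau> * \<Delta>) * real s"
        using s1 p by (intro mult_left_mono) auto
      ultimately show ?thesis by (simp add: mult_ac)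
    qed simp
    define V where "V = vandermonde N xs"
    have dim: "dim_col V = s" by (simp add: V_def vandermonde_def s)
    then obtain c where c: "c \<in> carrier_vec s" "l2_norm c = 1" "l2_norm (V *\<^sub>v c) = sigma_min V"
      using sigma_min_attained[of V] l by auto
    have c1: "(\<Sum>j<s. (norm (c $ j))\<^sup>2) = 1"
      using c(1,2) unfolding l2_norm_def L2_set_def by auto
    have "real N * ((real N * \<Delta>) ^ (l - 1))\<^sup>2 * (\<Sum>j<s. (norm (c $ j))\<^sup>2)
      \<le> 4 * (exp 1)\<^sup>2 * ((32 * exp 1) ^ (l - 1))\<^sup>2 *
        energy N (expsum {..<s} (\<lambda>j. c $ j) (\<lambda>j. cis (xs ! j)))"
    proof (rule clustered_energy_bound[where \<rho> = "\<tau> * \<Delta>" and \<theta> = \<theta>])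
      show "2 * crosstalk l * real (card {..<s}) \<le> real N * \<theta>" using N1 pos by (simp add: field_simps)
      \<comment> \<open>For \<open>l \<ge> 2\<close> the configuration has \<open>\<tau> \<ge> l - 1 \<ge> 1\<close>.\<close>
      show "real N * \<Delta> \<le> 1" if "l \<ge> 2"
      proof -
        have "1 \<le> \<tau>" using that \<tau> by linarith
        then have "real N * (1 * \<Delta>) \<le> real N * (\<tau> * \<Delta>)"
          using pos by (intro mult_left_mono mult_right_mono) auto
        then show ?thesis using N\<rho> by simp
      qed
      fix i assume "i \<in> {..<s}"
      then obtain Y where Y: "Y \<subseteq> set xs" "card Y \<le> l"
        "\<forall>z\<in>Y - {xs ! i}. \<Delta> \<le> wrap_dist z (xs ! i) \<and> wrap_dist z (xs ! i) \<le> \<tau> * \<Delta>"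
        "\<forall>z\<in>set xs - Y. \<theta> \<le> wrap_dist z (xs ! i)"
        using cl[of "xs ! i"] s by auto
      define Y' where "Y' = {j. j < s \<and> xs ! j \<in> Y}"
      have "card Y' \<le> card Y"
        using xs s Y(1) unfolding Y'_def
        by (intro card_inj_on_le[where f = "\<lambda>j. xs ! j"])
          (auto simp: inj_on_def nth_eq_iff_index_eq intro: finite_subset)
      then show "\<exists>Y\<subseteq>{..<s}. card Y \<le> l \<and>
        (\<forall>j\<in>Y - {i}. \<Delta> \<le> wrap_dist (xs ! j) (xs ! i) \<and> wrap_dist (xs ! j) (xs ! i) \<le> \<tau> * \<Delta>) \<and>
        (\<forall>j\<in>{..<s} - Y. \<theta> \<le> wrap_dist (xs ! j) (xs ! i))"
        using Y xs s \<open>i \<in> {..<s}\<close> unfolding Y'_def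
        by (intro exI[of _ "{j. j < s \<and> xs ! j \<in> Y}"]) (auto simp: nth_eq_iff_index_eq)
    qed (use l pos \<open>\<theta> \<le> pi\<close> \<tau>0 N\<rho> in auto)
    then have bound: "real N * ((real N * \<Delta>) ^ (l - 1))\<^sup>2 \<le>
        4 * (exp 1)\<^sup>2 * ((32 * exp 1) ^ (l - 1))\<^sup>2 * (sigma_min V)\<^sup>2"
      unfolding c1 using energy_vandermonde[of c xs N] c by (simp add: s V_def)
    define q where "q = ((32 * exp 1) ^ (l - 1) :: real)"
    have q: "q > 0" by (simp add: q_def)
    have "(real N * \<Delta> / (32 * pi * exp 1)) ^ (l - 1) \<le> (real N * \<Delta> / (32 * exp 1)) ^ (l - 1)"
      using pos pi_gt3 by (intro power_mono divide_left_mono) auto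
    also have "\<dots> = (real N * \<Delta>) ^ (l - 1) / q" by (simp add: q_def power_divide)
    finally have "1 / (2 * exp 1) * sqrt (real N) * (real N * \<Delta> / (32 * pi * exp 1)) ^ (l - 1) \<le>
        1 / (2 * exp 1) * sqrt (real N) * ((real N * \<Delta>) ^ (l - 1) / q)"
      by (intro mult_left_mono) auto
    also have "\<dots> \<le> sigma_min V"
    proof (rule power2_le_imp_le)
      have "(1 / (2 * exp 1) * sqrt (real N) * ((real N * \<Delta>) ^ (l - 1) / q))\<^sup>2 =
          real N * ((real N * \<Delta>) ^ (l - 1))\<^sup>2 / (4 * (exp 1)\<^sup>2 * q\<^sup>2)"
        by (simp add: power_mult_distrib power_divide)
      also have "\<dots> \<le> (sigma_min V)\<^sup>2"
        using bound q unfolding q_def[symmetric] by (simp add: divide_le_eq mult_ac)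
      finally show "(1 / (2 * exp 1) * sqrt (real N) * ((real N * \<Delta>) ^ (l - 1) / q))\<^sup>2
          \<le> (sigma_min V)\<^sup>2" .
      show "0 \<le> sigma_min V" unfolding c(3)[symmetric] l2_norm_def by simp
    qed
    finally show ?thesis unfolding V_def .
  qed
  have positive: "crosstalk l > 0" if "l \<ge> 1" for l
    using that unfolding crosstalk_def by simp
  show ?thesis
    unfolding Let_def
  proof (rule exI[of _ "\<lambda>l. 2 * crosstalk l"], rule exI[of _ "\<lambda>_. 1"],
      rule exI[of _ "1 / (2 * exp 1)"], intro conjI allI impI)
    show "0 < 2 * crosstalk l" if "1 \<le> l" for l
      using positive[OF that] by simp
  next
    fix xs \<Delta> \<theta> s l \<tau> N
    assume "distinct xs \<and> clustered_configuration \<Delta> \<theta> s l \<tau> (set xs) \<and> \<theta> \<le> pi \<and> s \<le> N + 1 \<and>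
      2 * crosstalk l * real s / \<theta> \<le> real N \<and> (\<tau> \<noteq> 0 \<longrightarrow> real N \<le> 1 / (real s * \<tau> * \<Delta>))"
    then show "1 / (2 * exp 1) * sqrt (real N) * (real N * \<Delta> / (32 * pi * exp 1)) ^ (l - 1)
        \<le> sigma_min (vandermonde N xs)"
      by (elim conjE) (rule main)
  qed auto
qed

end
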